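(* Let $g\in\mathrm{BMOA}$ be non-constant. For $1\leq p_1<p_2<+\infty$, we have $$[T_g,H^{p_2}]\subsetneq [T_g,H^{p_1}].$$
   Context: $\mathbb D$ is the open unit disk and $\mathrm{Hol}(\mathbb D)$ is the space of analytic functions on $\mathbb D$. For $1\le p<\infty$, $H^p$ is the Hardy space of $f\in\mathrm{Hol}(\mathbb D)$ with $\|f\|_p=\sup_{0\le r<1}\left(\int_0^{2\pi}|f(re^{it})|^p\frac{dt}{2\pi}\right)^{1/p}<\infty$. $\mathrm{BMOA}$ is the space of $g\in H^2$ with $\sup_{a\in\mathbb D}\|g\circ\phi_a-g(a)\|_2<\infty$, where $\phi_a(z)=\frac{a-z}{1-\overline a z}$. For $f,g\in\mathrm{Hol}(\mathbb D)$, the generalized Volterra operator is $T_g(f)(z)=\int_0^z f(\zeta)g'(\zeta)\,d\zeta$, $z\in\mathbb D$. The optimal domain is $[T_g,H^p]=\{f\in\mathrm{Hol}(\mathbb D): T_g(f)\in H^p\}$. *)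

theory Defs
  imports "HOL-Complex_Analysis.Complex_Analysis"
begin

(* A function on the unit disk is represented by a total function on the complex plane, with
   unconstrained values outside the disk. Norms and membership in the spaces below depend only on
   the values on the disk. *)

abbreviation unit_disk :: "complex set" where
  "unit_disk \<equiv> ball 0 1"

definition hardy_norm :: "real \<Rightarrow> (complex \<Rightarrow> complex) \<Rightarrow> ennreal" where
  "hardy_norm p f =
     (SUP r\<in>{0..<1::real}.
        ennreal ((integral {0..2*pi} (\<lambda>t. norm (f (of_real r * exp (\<i> * of_real t))) powr p / (2*pi)))
                   powr (1/p)))"

definition hardy_space :: "real \<Rightarrow> (complex \<Rightarrow> complex) set" where
  "hardy_space p = {f. f holomorphic_on unit_disk \<and> hardy_norm p f < \<infinity>}"

definition disk_involution :: "complex \<Rightarrow> complex \<Rightarrow> complex" where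
  "disk_involution a z = (a - z) / (1 - cnj a * z)"

definition BMOA :: "(complex \<Rightarrow> complex) set" where
  "BMOA = {g \<in> hardy_space 2.
     (SUP a\<in>unit_disk. hardy_norm 2 (\<lambda>z. g (disk_involution a z) - g a)) < \<infinity>}"

(* The integrand is holomorphic on the disk whenever f and g are, so the integral from 0 to z
   does not depend on the path; the straight segment is used. *)
definition volterra :: "(complex \<Rightarrow> complex) \<Rightarrow> (complex \<Rightarrow> complex) \<Rightarrow> complex \<Rightarrow> complex" where
  "volterra g f z = contour_integral (linepath 0 z) (\<lambda>\<zeta>. f \<zeta> * deriv g \<zeta>)"

definition optimal_domain ::
  "((complex \<Rightarrow> complex) \<Rightarrow> complex \<Rightarrow> complex) \<Rightarrow> (complex \<Rightarrow> complex) set \<Rightarrow> (complex \<Rightarrow> complex) set" where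
  "optimal_domain T X = {f. f holomorphic_on unit_disk \<and> T f \<in> X}"

end

theory Submission
  imports Defs
begin

text \<open>The set of all holomorphic \<open>F\<close> for which \<open>F'\<close> is a holomorphic multiple of \<open>g'\<close> is
  closed under composition with holomorphic functions, and up to constants its members are exactly
  the functions \<open>T\<^sub>g f\<close>. So it suffices to find \<open>F\<close> in this set lying in \<open>H\<^sup>p\<close> for
  \<open>p = p1\<close> but not for \<open>p = p2\<close>.

  If the set contains an unbounded \<open>U\<close> lying in every \<open>H\<^sup>q\<close>, a gliding hump argument yields an
  entire \<open>\<Phi>\<close> such that \<open>F = \<Phi> \<circ> U\<close> works. For unbounded \<open>g\<close> take \<open>U = g\<close>, since
  BMOA functions lie in every \<open>H\<^sup>q\<close>. For bounded \<open>g\<close> pick \<open>w\<close> in the closure of the range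
  of \<open>g\<close> with maximal modulus; then \<open>U = w / (w - g)\<close> is unbounded with positive real part, so it
  lies in \<open>H\<^sup>q\<close> at least for \<open>q = 1 / 2\<close>. Either \<open>U\<close> lies in every \<open>H\<^sup>q\<close>, or a suitable power
  of \<open>U\<close> separates the two spaces.\<close>

section \<open>Circle means and Hardy spaces\<close>

text \<open>Boundary values are avoided throughout: every quantity is a mean over a circle inside
  the disk, bounded uniformly in the radius.

  The humps are monomials \<open>c * U ^ k\<close>. If none of them had small
  \<open>p1\<close>-means and a large \<open>p2\<close>-mean, the means of powers of
  \<open>U\<close> would satisfy a reverse Hoelder inequality with a constant independent of
  \<open>k\<close>. Such an inequality improves itself to exponential growth of the means in the
  exponent, and that forces \<open>U\<close> to be bounded.

  That BMOA lies in every H^q usually rests on the John-Nirenberg inequality. Here a dilate g(r z)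
  is replaced by a polynomial \<open>T\<close> at distance less than 1 on the closed disk. The
  harmonic extension of |T|^2 from the unit circle is Re H for a polynomial \<open>H\<close>, and Re
  H - |T|^2 at a point \<open>a\<close> is exactly the mean square oscillation of \<open>T\<close>
  about \<open>a\<close>, hence bounded independently of r and \<open>a\<close>. This bounded defect
  enters as the weight of a subharmonic function, which controls the mean of |T|^(2n+2) by that of
  |T|^(2n).\<close>

definition circle_mean :: "(complex \<Rightarrow> 'a::banach) \<Rightarrow> real \<Rightarrow> 'a" where
  "circle_mean F r = integral {0..2*pi} (\<lambda>t. F (of_real r * exp (\<i> * of_real t))) /\<^sub>R (2*pi)"

lemma circle_integrable:
  fixes F :: "complex \<Rightarrow> 'a::banach"
  assumes "continuous_on (sphere 0 r) F" "0 \<le> r"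
  shows "(\<lambda>t. F (of_real r * exp (\<i> * of_real t))) integrable_on {0..2*pi}"
  by (intro integrable_continuous_real continuous_on_compose2[OF assms(1)] continuous_intros)
     (use assms(2) in \<open>auto simp: norm_mult\<close>)

lemma circle_mean_cong:
  assumes "\<And>z. z \<in> sphere 0 r \<Longrightarrow> F z = G z" "0 \<le> r"
  shows "circle_mean F r = circle_mean G r"
  using assms by (simp add: circle_mean_def norm_mult)

lemma circle_mean_const [simp]: "circle_mean (\<lambda>z. c) r = c"
  by (simp add: circle_mean_def scaleR_scaleR)

lemma circle_mean_zero [simp]: "circle_mean F 0 = F 0"
  by (simp add: circle_mean_def scaleR_scaleR)

lemma circle_mean_add:
  assumes "continuous_on (sphere 0 r) F" "continuous_on (sphere 0 r) G" "0 \<le> r"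
  shows "circle_mean (\<lambda>z. F z + G z) r = circle_mean F r + circle_mean G r"
  unfolding circle_mean_def
  using integral_add[OF circle_integrable[OF assms(1,3)] circle_integrable[OF assms(2,3)]]
  by (simp add: scaleR_add_right)

lemma circle_mean_bounded_linear:
  assumes "bounded_linear h" "continuous_on (sphere 0 r) F" "0 \<le> r"
  shows "circle_mean (\<lambda>z. h (F z)) r = h (circle_mean F r)"
  using integral_linear[OF circle_integrable[OF assms(2,3)] assms(1)]
  by (simp add: circle_mean_def o_def linear_cmul[OF bounded_linear.linear[OF assms(1)]])

lemma circle_mean_mult:
  fixes F :: "complex \<Rightarrow> 'a::{banach,real_normed_algebra}"
  assumes "continuous_on (sphere 0 r) F" "0 \<le> r"
  shows "circle_mean (\<lambda>z. c * F z) r = c * circle_mean F r"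
  by (rule circle_mean_bounded_linear[OF bounded_linear_mult_right assms])

lemma circle_mean_Re:
  assumes "continuous_on (sphere 0 r) F" "0 \<le> r"
  shows "circle_mean (\<lambda>z. Re (F z)) r = Re (circle_mean F r)"
  by (rule circle_mean_bounded_linear[OF bounded_linear_Re assms])

lemma circle_mean_sum:
  assumes "\<And>j. j \<in> J \<Longrightarrow> continuous_on (sphere 0 r) (F j)" "0 \<le> r"
  shows "circle_mean (\<lambda>z. \<Sum>j\<in>J. F j z) r = (\<Sum>j\<in>J. circle_mean (F j) r)"
  using assms(1)
proof (induction J rule: infinite_finite_induct)
  case (insert x J)
  then show ?case
    using circle_mean_add[of r "F x" "\<lambda>z. \<Sum>j\<in>J. F j z"] assms(2)
    by (auto intro!: continuous_on_sum)
qed auto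

lemma circle_mean_mono:
  fixes F G :: "complex \<Rightarrow> real"
  assumes "continuous_on (sphere 0 r) F" "continuous_on (sphere 0 r) G" "0 \<le> r"
    and "\<And>z. z \<in> sphere 0 r \<Longrightarrow> F z \<le> G z"
  shows "circle_mean F r \<le> circle_mean G r"
  unfolding circle_mean_def
  using integral_le[OF circle_integrable[OF assms(1,3)] circle_integrable[OF assms(2,3)]] assms(3,4)
  by (auto simp: norm_mult intro!: mult_left_mono)

lemma circle_mean_nonneg:
  fixes F :: "complex \<Rightarrow> real"
  assumes "continuous_on (sphere 0 r) F" "0 \<le> r" "\<And>z. z \<in> sphere 0 r \<Longrightarrow> 0 \<le> F z"
  shows "0 \<le> circle_mean F r"
  using circle_mean_mono[of r "\<lambda>_. 0" F] assms by simp

lemma circle_mean_norm_le: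
  assumes "continuous_on (sphere 0 r) F" "0 \<le> r"
  shows "norm (circle_mean F r) \<le> circle_mean (\<lambda>z. norm (F z)) r"
proof -
  have "norm (integral {0..2*pi} (\<lambda>t. F (of_real r * exp (\<i> * of_real t))))
    \<le> integral {0..2*pi} (\<lambda>t. norm (F (of_real r * exp (\<i> * of_real t))))"
    by (intro integral_norm_bound_integral circle_integrable continuous_on_norm assms) simp
  then show ?thesis by (simp add: circle_mean_def divide_right_mono field_simps)
qed

text \<open>On the circle du = i u dt; this accounts for the extra factor \<open>z\<close> and turns
  Cauchy's formula into a mean.\<close>

lemma Cauchy_circle_mean:
  assumes "continuous_on (cball 0 r) F" "F holomorphic_on ball 0 r" "norm w < r"
  shows "circle_mean (\<lambda>z. F z * z / (z - w)) r = F w"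
proof -
  have r: "0 < r" using assms(3) norm_ge_zero[of w] by linarith
  have "((\<lambda>u. F u / (u - w)) has_contour_integral 2 * of_real pi * \<i> * F w) (circlepath 0 r)"
    using Cauchy_integral_circlepath[OF assms(1,2)] assms(3) by simp
  then have "contour_integral (circlepath 0 r) (\<lambda>u. F u / (u - w)) = 2 * of_real pi * \<i> * F w"
    by (rule contour_integral_unique)
  also have "contour_integral (circlepath 0 r) (\<lambda>u. F u / (u - w))
    = integral {0..2*pi} (\<lambda>t. \<i> * (F (of_real r * exp (\<i> * of_real t)) * (of_real r * exp (\<i> * of_real t))
        / (of_real r * exp (\<i> * of_real t) - w)))"
    unfolding circlepath_def
    by (subst contour_integral_part_circlepath_eq) (auto simp: cis_conv_exp field_simps intro!: integral_cong)
  also have "\<dots> = \<i> * integral {0..2*pi} (\<lambda>t. F (of_real r * exp (\<i> * of_real t)) * (of_real r * exp (\<i> * of_real t))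
        / (of_real r * exp (\<i> * of_real t) - w))"
    by (rule integral_mult_right)
  finally show ?thesis by (simp add: circle_mean_def scaleR_conv_of_real field_simps)
qed

lemma circle_mean_holomorphic:
  assumes "continuous_on (cball 0 r) F" "F holomorphic_on ball 0 r" "0 < r"
  shows "circle_mean F r = F 0"
proof -
  have "circle_mean F r = circle_mean (\<lambda>z. F z * z / (z - 0)) r"
    using assms(3) by (intro circle_mean_cong) auto
  then show ?thesis using Cauchy_circle_mean[OF assms(1,2), of 0] assms(3) by simp
qed

text \<open>A crude form of the Poisson bound. The factor depends only on \<open>w\<close> and
  \<open>r\<close>, so when the estimate is applied to all powers of one function it disappears in
  the limit of kth roots.\<close>

lemma norm_le_circle_mean:
  assumes "continuous_on (cball 0 r) F" "F holomorphic_on ball 0 r" "norm w < r"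
  shows "norm (F w) \<le> r / (r - norm w) * circle_mean (\<lambda>z. norm (F z)) r"
proof -
  have r: "0 < r" using assms(3) norm_ge_zero[of w] by linarith
  have cF: "continuous_on (sphere 0 r) F"
    using assms(1) by (rule continuous_on_subset) auto
  have c: "continuous_on (sphere 0 r) (\<lambda>z. F z * z / (z - w))"
    by (intro continuous_intros cF) (use assms(3) in auto)
  have "norm (F w) \<le> circle_mean (\<lambda>z. norm (F z * z / (z - w))) r"
    using circle_mean_norm_le[OF c] Cauchy_circle_mean[OF assms] r by simp
  also have "\<dots> \<le> circle_mean (\<lambda>z. r / (r - norm w) * norm (F z)) r"
  proof (rule circle_mean_mono)
    fix z :: complex assume "z \<in> sphere 0 r"
    then have z: "norm z = r" by simp
    then have "r - norm w \<le> norm (z - w)" by (metis norm_triangle_ineq2)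
    then have "norm (F z) * r / norm (z - w) \<le> norm (F z) * r / (r - norm w)"
      using r assms(3) by (intro divide_left_mono mult_nonneg_nonneg mult_pos_pos) auto
    then show "norm (F z * z / (z - w)) \<le> r / (r - norm w) * norm (F z)"
      using z by (simp add: norm_mult norm_divide mult_ac)
  qed (use r assms(3) in \<open>auto intro!: continuous_intros cF\<close>)
  also have "\<dots> = r / (r - norm w) * circle_mean (\<lambda>z. norm (F z)) r"
    using r by (intro circle_mean_mult continuous_intros cF) auto
  finally show ?thesis .
qed

section \<open>Hardy space membership as boundedness of means, for all positive exponents\<close>

definition bounded_means :: "real \<Rightarrow> (complex \<Rightarrow> complex) \<Rightarrow> bool" where
  "bounded_means p F \<longleftrightarrow> (\<exists>B. \<forall>r\<in>{0..<1}. circle_mean (\<lambda>z. norm (F z) powr p) r \<le> B)"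

lemma circle_mean_eq_integral:
  "integral {0..2*pi} (\<lambda>t. norm (F (of_real r * exp (\<i> * of_real t))) powr p / (2*pi))
     = circle_mean (\<lambda>z. norm (F z) powr p) r"
  by (simp add: circle_mean_def field_simps)

lemma sphere_subset_disk: "r < 1 \<Longrightarrow> sphere 0 r \<subseteq> unit_disk"
  by auto

lemma continuous_on_norm_powr:
  fixes F :: "complex \<Rightarrow> complex"
  assumes "continuous_on unit_disk F" "0 < p" "r < 1"
  shows "continuous_on (sphere 0 r) (\<lambda>z. norm (F z) powr p)"
  using continuous_on_subset[OF assms(1) sphere_subset_disk[OF assms(3)]] assms(2)
  by (intro continuous_on_powr' continuous_on_norm continuous_on_const) auto

lemma hardy_norm_finite_imp:
  assumes "hardy_norm p F \<le> ennreal C" "0 < p" "0 \<le> C" "continuous_on unit_disk F" "0 \<le> r" "r < 1"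
  shows "circle_mean (\<lambda>z. norm (F z) powr p) r \<le> C powr p"
proof -
  let ?m = "circle_mean (\<lambda>z. norm (F z) powr p) r"
  have nn: "0 \<le> ?m" using assms by (intro circle_mean_nonneg continuous_on_norm_powr) auto
  have "ennreal (?m powr (1/p)) \<le> hardy_norm p F"
    unfolding hardy_norm_def circle_mean_eq_integral using assms by (intro SUP_upper) auto
  then have "?m powr (1/p) \<le> C"
    using assms(1,3) by (metis ennreal_le_iff order_trans)
  then have "(?m powr (1/p)) powr p \<le> C powr p"
    using assms(2) by (intro powr_mono2) auto
  then show ?thesis using nn assms(2) by (simp add: powr_powr)
qed

lemma hardy_space_iff:
  assumes "0 < p"
  shows "F \<in> hardy_space p \<longleftrightarrow> F holomorphic_on unit_disk \<and> bounded_means p F"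
proof -
  have "hardy_norm p F < \<infinity> \<longleftrightarrow> bounded_means p F" if hF: "F holomorphic_on unit_disk"
  proof
    assume "hardy_norm p F < \<infinity>"
    then obtain C where C: "hardy_norm p F = ennreal C" "0 \<le> C"
      by (cases "hardy_norm p F") auto
    show "bounded_means p F" unfolding bounded_means_def
      using hardy_norm_finite_imp[of p F C] C assms holomorphic_on_imp_continuous_on[OF hF]
      by (intro exI[of _ "C powr p"]) auto
  next
    assume "bounded_means p F"
    then obtain B where B: "\<And>r. r \<in> {0..<1} \<Longrightarrow> circle_mean (\<lambda>z. norm (F z) powr p) r \<le> B"
      unfolding bounded_means_def by blast
    have "hardy_norm p F \<le> ennreal (B powr (1/p))"
      unfolding hardy_norm_def circle_mean_eq_integral
    proof (rule SUP_least)
      fix r :: real assume r: "r \<in> {0..<1}"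
      have "0 \<le> circle_mean (\<lambda>z. norm (F z) powr p) r"
        using r assms holomorphic_on_imp_continuous_on[OF hF]
        by (intro circle_mean_nonneg continuous_on_norm_powr) auto
      then show "ennreal (circle_mean (\<lambda>z. norm (F z) powr p) r powr (1/p)) \<le> ennreal (B powr (1/p))"
        using B[OF r] assms by (intro ennreal_leI powr_mono2) auto
    qed
    then show "hardy_norm p F < \<infinity>" using ennreal_less_top le_less_trans by (metis infinity_ennreal_def)
  qed
  then show ?thesis by (auto simp: hardy_space_def)
qed

text \<open>A sum is at most twice the larger summand. No convexity is involved, so exponents below
  1 are covered.\<close>

lemma powr_sum_le:
  fixes x y :: "'a::real_normed_vector"
  assumes "0 < p"
  shows "norm (x + y) powr p \<le> 2 powr p * (norm x powr p + norm y powr p)"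
proof -
  have "norm (x + y) powr p \<le> (2 * max (norm x) (norm y)) powr p"
    using norm_triangle_ineq[of x y] assms by (intro powr_mono2) auto
  also have "\<dots> = 2 powr p * max (norm x) (norm y) powr p" by (simp add: powr_mult)
  also have "max (norm x) (norm y) powr p \<le> norm x powr p + norm y powr p" by (simp add: max_def)
  finally show ?thesis by simp
qed

text \<open>Two separate exponents are allowed so that the same comparison gives monotonicity in the
  exponent and the passage from \<open>U\<close> to multiples of \<open>U ^ k\<close>.\<close>

lemma bounded_means_dominated:
  assumes "continuous_on unit_disk F" "continuous_on unit_disk G" "0 < p" "0 < q"
    and "bounded_means q G"
    and "\<And>z. z \<in> unit_disk \<Longrightarrow> norm (F z) powr p \<le> A * norm (G z) powr q + B" "0 \<le> A"
  shows "bounded_means p F"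
proof -
  obtain C where C: "\<And>r. r \<in> {0..<1} \<Longrightarrow> circle_mean (\<lambda>z. norm (G z) powr q) r \<le> C"
    using assms(5) unfolding bounded_means_def by blast
  have "circle_mean (\<lambda>z. norm (F z) powr p) r \<le> A * C + B" if r: "r \<in> {0..<1}" for r
  proof -
    have cG: "continuous_on (sphere 0 r) (\<lambda>z. norm (G z) powr q)"
      using r assms by (intro continuous_on_norm_powr) auto
    have "circle_mean (\<lambda>z. norm (F z) powr p) r \<le> circle_mean (\<lambda>z. A * norm (G z) powr q + B) r"
      using r assms(1-4) by (intro circle_mean_mono continuous_on_norm_powr continuous_intros cG assms(6)) auto
    also have "\<dots> = A * circle_mean (\<lambda>z. norm (G z) powr q) r + B"
      using r cG by (subst circle_mean_add) (auto intro!: continuous_intros simp: circle_mean_mult)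
    also have "\<dots> \<le> A * C + B" using C[OF r] assms(7) by (simp add: mult_left_mono)
    finally show ?thesis .
  qed
  then show ?thesis unfolding bounded_means_def by blast
qed

lemma bounded_means_mono:
  assumes "continuous_on unit_disk F" "0 < p" "p \<le> q" "bounded_means q F"
  shows "bounded_means p F"
proof (rule bounded_means_dominated[OF assms(1,1,2) _ assms(4), of 1 1])
  fix z
  show "norm (F z) powr p \<le> 1 * norm (F z) powr q + 1"
  proof (cases "norm (F z) \<le> 1")
    case True
    then have "norm (F z) powr p \<le> 1 powr p" using assms by (intro powr_mono2) auto
    then show ?thesis by (simp add: add_increasing)
  next
    case False
    then have "norm (F z) powr p \<le> norm (F z) powr q" using assms by (intro powr_mono) auto
    then show ?thesis by simp
  qed
qed (use assms in auto)

lemma bounded_means_add: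
  assumes "continuous_on unit_disk F" "continuous_on unit_disk G" "0 < p"
    "bounded_means p F" "bounded_means p G"
  shows "bounded_means p (\<lambda>z. F z + G z)"
proof -
  obtain B C where B: "\<And>r. r \<in> {0..<1} \<Longrightarrow> circle_mean (\<lambda>z. norm (F z) powr p) r \<le> B"
    and C: "\<And>r. r \<in> {0..<1} \<Longrightarrow> circle_mean (\<lambda>z. norm (G z) powr p) r \<le> C"
    using assms(4,5) unfolding bounded_means_def by blast
  have "circle_mean (\<lambda>z. norm (F z + G z) powr p) r \<le> 2 powr p * (B + C)" if r: "r \<in> {0..<1}" for r
  proof -
    have c: "continuous_on (sphere 0 r) (\<lambda>z. norm (F z) powr p)" "continuous_on (sphere 0 r) (\<lambda>z. norm (G z) powr p)"
      using r assms by (auto intro!: continuous_on_norm_powr)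
    have "circle_mean (\<lambda>z. norm (F z + G z) powr p) r
        \<le> circle_mean (\<lambda>z. 2 powr p * (norm (F z) powr p + norm (G z) powr p)) r"
      using r assms(1-3) by (intro circle_mean_mono continuous_on_norm_powr continuous_intros c powr_sum_le) auto
    also have "\<dots> = 2 powr p * (circle_mean (\<lambda>z. norm (F z) powr p) r + circle_mean (\<lambda>z. norm (G z) powr p) r)"
      using r c by (simp add: circle_mean_mult circle_mean_add continuous_intros)
    also have "\<dots> \<le> 2 powr p * (B + C)" using B[OF r] C[OF r] by simp
    finally show ?thesis .
  qed
  then show ?thesis unfolding bounded_means_def by blast
qed

lemma bounded_means_const: "bounded_means p (\<lambda>z. c)"
  by (auto simp: bounded_means_def)

lemma bounded_means_diff_const:
  assumes "continuous_on unit_disk F" "0 < p"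
  shows "bounded_means p (\<lambda>z. F z - c) \<longleftrightarrow> bounded_means p F"
  using bounded_means_add[of F "\<lambda>_. -c" p] bounded_means_add[of "\<lambda>z. F z - c" "\<lambda>_. c" p]
    bounded_means_const[of p c] bounded_means_const[of p "-c"] assms
  by (auto simp: continuous_on_diff)

section \<open>Gliding hump\<close>

text \<open>A supremum in \<open>real\<close>, meaningful only when the means are bounded above;
  hence the \<open>bdd_above\<close> hypotheses below.\<close>

definition sup_mean :: "(complex \<Rightarrow> real) \<Rightarrow> real \<Rightarrow> real" where
  "sup_mean v q = (SUP r\<in>{0..<1}. circle_mean (\<lambda>z. v z powr q) r)"

lemma circle_mean_le_sup_mean:
  assumes "bdd_above ((\<lambda>r. circle_mean (\<lambda>z. v z powr q) r) ` {0..<1})" "r \<in> {0..<1}"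
  shows "circle_mean (\<lambda>z. v z powr q) r \<le> sup_mean v q"
  unfolding sup_mean_def by (rule cSUP_upper[OF assms(2,1)])

text \<open>A reverse Hoelder inequality with one constant for all \<open>k\<close> improves itself.
  Split \<open>v powr q\<close> at a level l: below it is at most l^(q-1) v, above at most l^(q-s)
  v^s. By hypothesis the upper part can be absorbed into the left side, so exponent q is compared
  directly with exponent 1, without iteration over \<open>k\<close>.\<close>

lemma sup_mean_growth:
  fixes v :: "complex \<Rightarrow> real"
  assumes cont: "continuous_on unit_disk v" and ge1: "\<And>z. z \<in> unit_disk \<Longrightarrow> 1 \<le> v z"
    and bdd: "\<And>q. 0 < q \<Longrightarrow> bdd_above ((\<lambda>r. circle_mean (\<lambda>z. v z powr q) r) ` {0..<1})"
    and p: "1 \<le> p1" "p1 < p2" and C: "1 \<le> C"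
    and le: "\<And>k. (1::nat) \<le> k \<Longrightarrow> sup_mean v (k * p2) \<le> C * sup_mean v (k * p1) powr (p2 / p1)"
  shows "\<exists>\<Lambda>>0. \<forall>k\<ge>(1::nat). sup_mean v (real k * p1) \<le> \<Lambda> powr (real k * p1)"
proof -
  define J where "J = sup_mean v"
  define \<rho> where "\<rho> = p2 / p1"
  \<comment> \<open>Chosen so that \<open>D powr (1 - \<rho>)\<close> equals
    \<open>1 / (2 * C)\<close>: the bound for the part above the level then becomes exactly
    \<open>J q / 2\<close>.\<close>
  define D where "D = (2 * C) powr (1 / (\<rho> - 1))"
  have \<rho>: "1 < \<rho>" using p by (simp add: \<rho>_def)
  have D1: "1 \<le> D" unfolding D_def using C \<rho> by (intro ge_one_powr_ge_zero) auto
  have cv: "continuous_on (sphere 0 r) (\<lambda>z. v z powr q)" if "r < 1" for q r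
  proof -
    have "v z \<noteq> 0" if "z \<in> sphere 0 r" for z using ge1[of z] that \<open>r < 1\<close> by auto
    then show ?thesis using continuous_on_subset[OF cont sphere_subset_disk[OF that]]
      by (intro continuous_on_powr continuous_on_const) auto
  qed
  have J1: "1 \<le> J q" if "0 < q" for q
  proof -
    have "1 = circle_mean (\<lambda>z. 1 :: real) 0" by simp
    also have "\<dots> \<le> circle_mean (\<lambda>z. v z powr q) 0"
      using that by (intro circle_mean_mono cv ge_one_powr_ge_zero ge1) auto
    also have "\<dots> \<le> J q" unfolding J_def by (intro circle_mean_le_sup_mean bdd that) auto
    finally show ?thesis .
  qed
  have "J (k * p1) \<le> (2 * J 1 * D) powr (k * p1)" if k: "(1::nat) \<le> k" for k :: nat
  proof -
    define q where "q = k * p1"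
    define s where "s = k * p2"
    have q: "1 \<le> q" unfolding q_def using k p(1)
      by (metis mult.right_neutral mult_mono of_nat_0_le_iff of_nat_1 of_nat_le_iff zero_le_one)
    have s: "s = \<rho> * q" using p by (simp add: s_def q_def \<rho>_def)
    \<comment> \<open>The splitting level is chosen so that the part of the mean above it is at most half of \<open>J q\<close>.\<close>
    define l where "l = (D * J q) powr (1 / q)"
    have Jq: "1 \<le> J q" using J1 q by auto
    have l0: "0 < l" using D1 Jq by (simp add: l_def)
    have lq: "l powr q = D * J q" using D1 Jq q by (simp add: l_def powr_powr)
    have ls: "l powr (q - s) = inverse (2 * C) * J q powr (1 - \<rho>)"
    proof -
      have "l powr (q - s) = (l powr q) powr (1 - \<rho>)"
        unfolding s by (simp add: powr_powr algebra_simps)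
      also have "\<dots> = D powr (1 - \<rho>) * J q powr (1 - \<rho>)"
        using D1 Jq by (simp add: lq powr_mult)
      also have "D powr (1 - \<rho>) = (2 * C) powr (-1)"
      proof -
        have "(1 / (\<rho> - 1)) * (1 - \<rho>) = -1" using \<rho> by (simp add: divide_simps)
        then show ?thesis by (simp only: D_def powr_powr)
      qed
      also have "\<dots> = inverse (2 * C)" using C by (simp add: powr_minus)
      finally show ?thesis .
    qed
    have pt: "v z powr q \<le> l powr (q - 1) * v z + l powr (q - s) * v z powr s" if "z \<in> unit_disk" for z
    proof (cases "v z \<le> l")
      case True
      have "v z powr q = v z powr (q - 1) * v z" using ge1[OF that] by (simp add: powr_diff)
      also have "\<dots> \<le> l powr (q - 1) * v z"
        using True ge1[OF that] q by (intro mult_right_mono powr_mono2) auto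
      finally show ?thesis by (simp add: add_increasing2)
    next
      case False
      have "v z powr q = v z powr (q - s) * v z powr s" using ge1[OF that] by (simp add: powr_diff)
      also have "\<dots> \<le> l powr (q - s) * v z powr s"
        using False l0 q \<rho> unfolding s by (intro mult_right_mono powr_mono2') auto
      finally show ?thesis using ge1[OF that] by (simp add: add_increasing)
    qed
    have "circle_mean (\<lambda>z. v z powr q) r \<le> l powr (q - 1) * J 1 + l powr (q - s) * J s"
      if r: "r \<in> {0..<1}" for r
    proof -
      have cv1: "continuous_on (sphere 0 r) v"
        using r by (intro continuous_on_subset[OF cont]) auto
      have v1: "circle_mean (\<lambda>z. v z powr 1) r = circle_mean v r"
        using r ge1 by (intro circle_mean_cong) (auto simp: subset_eq, smt (verit) mem_ball_0)
      have "circle_mean (\<lambda>z. v z powr q) r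
          \<le> circle_mean (\<lambda>z. l powr (q - 1) * v z + l powr (q - s) * v z powr s) r"
        using r by (intro circle_mean_mono cv continuous_intros cv1 pt) auto
      also have "\<dots> = l powr (q - 1) * circle_mean v r + l powr (q - s) * circle_mean (\<lambda>z. v z powr s) r"
        using r cv cv1 by (simp add: circle_mean_mult circle_mean_add continuous_on_mult_left)
      also have "\<dots> \<le> l powr (q - 1) * J 1 + l powr (q - s) * J s"
        unfolding J_def v1[symmetric] using q \<rho> r
        by (intro add_mono mult_left_mono circle_mean_le_sup_mean bdd) (auto simp: s)
      finally show ?thesis .
    qed
    then have "J q \<le> l powr (q - 1) * J 1 + l powr (q - s) * J s"
      unfolding J_def sup_mean_def by (intro cSUP_least) auto
    also have "\<dots> \<le> l powr (q - 1) * J 1 + l powr (q - s) * (C * J q powr \<rho>)"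
      using le[OF k] by (intro add_left_mono mult_left_mono) (auto simp: J_def q_def s_def \<rho>_def)
    also have "l powr (q - s) * (C * J q powr \<rho>) = J q / 2"
    proof -
      have "J q powr (1 - \<rho>) * J q powr \<rho> = J q" using Jq by (simp flip: powr_add)
      then show ?thesis unfolding ls using C by (simp add: field_simps)
    qed
    finally have "J q \<le> 2 * (l powr (q - 1) * J 1)" by simp
    \<comment> \<open>Now \<open>J q\<close> cancels from both sides, leaving a bound for the level
      that does not depend on \<open>k\<close>.\<close>
    also have "l powr (q - 1) = D * J q / l" using l0 lq by (simp add: powr_diff)
    finally have "l \<le> 2 * J 1 * D" using l0 Jq by (simp add: field_simps)
    then have "l powr q \<le> (2 * J 1 * D) powr q" using l0 q by (intro powr_mono2) auto
    moreover have "J q \<le> l powr q" using lq D1 Jq by simp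
    ultimately show ?thesis by (simp add: q_def)
  qed
  then show ?thesis using J1[of 1] D1
    by (intro exI[of _ "2 * J 1 * D"]) (auto simp: J_def)
qed

text \<open>The case \<open>k = 0\<close> is excluded because \<open>0 ^ 0 = 1\<close> whereas
  \<open>0 powr 0 = 0\<close>.\<close>

lemma powr_of_power:
  fixes x p :: real
  assumes "0 \<le> x" "(1::nat) \<le> k"
  shows "(x ^ k) powr p = x powr (real k * p)"
  using assms by (cases "x = 0") (auto simp: powr_powr simp flip: powr_realpow)

text \<open>Scale \<open>U ^ k\<close> so that the first two requirements hold. If the third then
  failed for every \<open>k\<close>, the \<open>p2\<close>-means would be controlled by the
  \<open>p1\<close>-means with a uniform constant, and \<open>sup_mean_growth\<close> would yield a
  bound for \<open>U\<close>.\<close>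

lemma exists_hump:
  fixes U :: "complex \<Rightarrow> complex"
  assumes hol: "U holomorphic_on unit_disk" and bm: "\<And>q. 0 < q \<Longrightarrow> bounded_means q U"
    and unb: "\<And>B. \<exists>z\<in>unit_disk. B < norm (U z)"
    and p: "1 \<le> p1" "p1 < p2" and e: "0 < \<epsilon>" "\<epsilon> \<le> 1" and R: "1 \<le> R" and L: "0 \<le> L"
  shows "\<exists>c>0. \<exists>k. c * R ^ k \<le> \<epsilon> \<and>
    (\<forall>r\<in>{0..<1}. circle_mean (\<lambda>z. norm (of_real c * U z ^ k) powr p1) r \<le> \<epsilon>) \<and>
    (\<exists>r\<in>{0..<1}. L < circle_mean (\<lambda>z. norm (of_real c * U z ^ k) powr p2) r)"
proof (rule ccontr)
  assume neg: "\<not> ?thesis"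
  \<comment> \<open>Truncation from below lets the \<open>p1\<close>-mean of \<open>v ^ k\<close> control \<open>R ^ k\<close> as well.\<close>
  define v where "v = (\<lambda>z. max (norm (U z)) R)"
  note contU = holomorphic_on_imp_continuous_on[OF hol]
  have cont: "continuous_on unit_disk v" unfolding v_def by (intro continuous_intros contU)
  have v1: "1 \<le> v z" for z using R by (simp add: v_def)
  have cU: "continuous_on (sphere 0 r) (\<lambda>z. norm (U z) powr q)" if "r < 1" "0 < q" for r q
    using that by (intro continuous_on_norm_powr contU)
  have cv: "continuous_on (sphere 0 r) (\<lambda>z. v z powr q)" if "r < 1" for q r
  proof -
    have "v z \<noteq> 0" for z using v1[of z] by auto
    then show ?thesis using continuous_on_subset[OF cont sphere_subset_disk[OF that]]
      by (intro continuous_on_powr continuous_on_const) auto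
  qed
  have vle: "circle_mean (\<lambda>z. v z powr q) r \<le> circle_mean (\<lambda>z. norm (U z) powr q) r + R powr q"
    if "r \<in> {0..<1}" "0 < q" for q r
  proof -
    have "circle_mean (\<lambda>z. v z powr q) r \<le> circle_mean (\<lambda>z. norm (U z) powr q + R powr q) r"
      using that by (intro circle_mean_mono cv continuous_intros cU) (auto simp: v_def max_def)
    then show ?thesis using that cU by (simp add: circle_mean_add)
  qed
  have bdd: "bdd_above ((\<lambda>r. circle_mean (\<lambda>z. v z powr q) r) ` {0..<1})" if q: "0 < q" for q
  proof -
    obtain B where B: "\<And>r. r \<in> {0..<1} \<Longrightarrow> circle_mean (\<lambda>z. norm (U z) powr q) r \<le> B"
      using bm[OF q] unfolding bounded_means_def by blast
    show ?thesis
    proof (rule bdd_aboveI2)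
      show "circle_mean (\<lambda>z. v z powr q) r \<le> B + R powr q" if "r \<in> {0..<1}" for r
        using vle[OF that q] B[OF that] by simp
    qed
  qed
  define J where "J = sup_mean v"
  have Jge: "circle_mean (\<lambda>z. v z powr q) r \<le> J q" if "r \<in> {0..<1}" "0 < q" for r q
    unfolding J_def by (intro circle_mean_le_sup_mean bdd that)
  have JR: "R powr q \<le> J q" if "0 < q" for q
  proof -
    have "R powr q = circle_mean (\<lambda>z. R powr q) 0" by simp
    also have "\<dots> \<le> circle_mean (\<lambda>z. v z powr q) 0"
      using that R by (intro circle_mean_mono cv powr_mono2) (auto simp: v_def)
    also have "\<dots> \<le> J q" using that by (intro Jge) auto
    finally show ?thesis .
  qed
  \<comment> \<open>\<open>L\<close> bounds the scaled \<open>p2\<close>-mean of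
    \<open>U ^ k\<close>, and 1 bounds the scaled contribution of the truncation level
    \<open>R\<close>; the power of \<open>\<epsilon>\<close> undoes the scaling.\<close>
  define C where "C = (L + 1) * \<epsilon> powr (- p2)"
  have C1: "1 \<le> C"
  proof -
    have "1 \<le> \<epsilon> powr (- p2)" using e p powr_mono'[of "-p2" 0 \<epsilon>] by simp
    then have "1 * 1 \<le> C" unfolding C_def using L by (intro mult_mono) auto
    then show ?thesis by simp
  qed
  have "J (k * p2) \<le> C * J (k * p1) powr (p2 / p1)" if k: "(1::nat) \<le> k" for k :: nat
  proof -
    define j where "j = J (k * p1)"
    have kp: "0 < k * p1" "0 < k * p2" using k p by auto
    have j: "0 < j" using JR[OF kp(1)] R by (smt (verit) j_def powr_gt_zero)
    \<comment> \<open>This makes \<open>c powr p1 * j\<close> equal to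
      \<open>\<epsilon> powr p1\<close>, which is at most \<open>\<epsilon>\<close> since
      \<open>\<epsilon> \<le> 1 \<le> p1\<close>. As \<open>j\<close> dominates both
      \<open>R powr (k * p1)\<close> and the means of \<open>U\<close>, only the \<open>p2\<close>
      requirement can fail.\<close>
    define c where "c = \<epsilon> * j powr (-1/p1)"
    have c: "0 < c" using e j by (simp add: c_def)
    have cp: "c powr p = \<epsilon> powr p * j powr (-p/p1)" for p
      using e j by (simp add: c_def powr_mult powr_powr)
    have c1: "c powr p1 * j = \<epsilon> powr p1" using p j by (simp add: cp powr_minus field_simps)
    have e1: "\<epsilon> powr p1 \<le> \<epsilon>" using e p powr_mono'[of 1 p1 \<epsilon>] by simp
    have Uk: "norm (of_real c * U z ^ k) powr p = c powr p * norm (U z) powr (k * p)" for z and p :: real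
      using c k by (simp add: norm_mult norm_power powr_mult powr_of_power)
    have mk: "circle_mean (\<lambda>z. norm (of_real c * U z ^ k) powr p) r
        = c powr p * circle_mean (\<lambda>z. norm (U z) powr (k * p)) r" if "r \<in> {0..<1}" "0 < p" for p r :: real
      unfolding Uk using that k by (intro circle_mean_mult cU) auto
    have "(c * R ^ k) powr p1 = c powr p1 * R powr (k * p1)"
      using c R k by (simp add: powr_mult powr_of_power)
    also have "\<dots> \<le> c powr p1 * j" using JR[OF kp(1)] by (simp add: j_def mult_left_mono)
    finally have "(c * R ^ k) powr p1 \<le> \<epsilon> powr p1" by (simp add: c1)
    then have cR: "c * R ^ k \<le> \<epsilon>"
      using powr_less_mono2[of p1 \<epsilon> "c * R ^ k"] p e by (cases "c * R ^ k \<le> \<epsilon>") auto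
    have "circle_mean (\<lambda>z. norm (of_real c * U z ^ k) powr p1) r \<le> \<epsilon>" if r: "r \<in> {0..<1}" for r
    proof -
      have "circle_mean (\<lambda>z. norm (U z) powr (k * p1)) r \<le> circle_mean (\<lambda>z. v z powr (k * p1)) r"
        using r kp by (intro circle_mean_mono cU cv powr_mono2) (auto simp: v_def)
      also have "\<dots> \<le> j" unfolding j_def by (intro Jge r kp)
      finally have "c powr p1 * circle_mean (\<lambda>z. norm (U z) powr (k * p1)) r \<le> c powr p1 * j"
        by (intro mult_left_mono) auto
      then show ?thesis using mk[OF r, of p1] p c1 e1 by linarith
    qed
    with neg cR c have "\<not> (\<exists>r\<in>{0..<1}. L < circle_mean (\<lambda>z. norm (of_real c * U z ^ k) powr p2) r)"
      by blast
    then have "circle_mean (\<lambda>z. norm (of_real c * U z ^ k) powr p2) r \<le> L" if "r \<in> {0..<1}" for r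
      using that by (meson not_less)
    then have cL: "c powr p2 * circle_mean (\<lambda>z. norm (U z) powr (k * p2)) r \<le> L" if "r \<in> {0..<1}" for r
      using mk[OF that, of p2] p that by fastforce
    have "circle_mean (\<lambda>z. v z powr (k * p2)) r \<le> (L + 1) / c powr p2" if r: "r \<in> {0..<1}" for r
    proof -
      have "c powr p2 * R powr (k * p2) = (c * R ^ k) powr p2"
        using c R k by (simp add: powr_mult powr_of_power)
      also have "\<dots> \<le> 1 powr p2" using cR e c R p by (intro powr_mono2) auto
      finally have "c powr p2 * (circle_mean (\<lambda>z. norm (U z) powr (k * p2)) r + R powr (k * p2)) \<le> L + 1"
        using cL[OF r] by (simp add: distrib_left)
      then have "c powr p2 * circle_mean (\<lambda>z. v z powr (k * p2)) r \<le> L + 1"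
        using mult_left_mono[OF vle[OF r kp(2)], of "c powr p2"] by simp
      then show ?thesis using c by (simp add: field_simps)
    qed
    then have "J (k * p2) \<le> (L + 1) / c powr p2"
      unfolding J_def sup_mean_def by (intro cSUP_least) auto
    also have "\<dots> = C * j powr (p2 / p1)"
      by (simp add: cp C_def powr_minus divide_simps)
    finally show ?thesis by (simp add: j_def)
  qed
  with sup_mean_growth[OF cont v1 bdd p C1] obtain \<Lambda> where
    \<Lambda>: "0 < \<Lambda>" "\<And>k. (1::nat) \<le> k \<Longrightarrow> J (real k * p1) \<le> \<Lambda> powr (real k * p1)"
    unfolding J_def by blast
  \<comment> \<open>The threshold is \<open>\<Lambda> powr p1\<close> rather than
    \<open>\<Lambda>\<close> because |U|^k will be estimated by \<open>v powr (k * p1)\<close>,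
    using \<open>1 \<le> v\<close> and \<open>1 \<le> p1\<close>.\<close>
  obtain w where w: "norm w < 1" "\<Lambda> powr p1 < norm (U w)"
    using unb[of "\<Lambda> powr p1"] by auto
  define r where "r = (norm w + 1) / 2"
  have r: "norm w < r" "r < 1" "0 < r" using w by (simp_all add: r_def add_nonneg_pos)
  define K where "K = r / (r - norm w)"
  have K: "0 < K" using r by (simp add: K_def)
  have "norm (U w) ^ k \<le> K * (\<Lambda> powr p1) ^ k" if k: "(1::nat) \<le> k" for k
  proof -
    have sub: "cball 0 r \<subseteq> unit_disk" using r by auto
    have cUr: "continuous_on (cball 0 r) U" by (rule continuous_on_subset[OF contU sub])
    have "norm (U w ^ k) \<le> K * circle_mean (\<lambda>z. norm (U z ^ k)) r"
      unfolding K_def using r sub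
      by (intro norm_le_circle_mean continuous_intros cUr holomorphic_intros
          holomorphic_on_subset[OF hol]) auto
    also have "\<dots> \<le> K * circle_mean (\<lambda>z. v z powr (k * p1)) r"
    proof (intro mult_left_mono circle_mean_mono cv)
      fix z
      have "norm (U z ^ k) \<le> v z ^ k" by (simp add: norm_power v_def power_mono)
      also have "\<dots> = v z powr real k" using v1[of z] by (simp add: powr_realpow)
      also have "\<dots> \<le> v z powr (k * p1)" using v1[of z] mult_left_mono[OF p(1), of "real k"] by (intro powr_mono) simp_all
      finally show "norm (U z ^ k) \<le> v z powr (k * p1)" .
    qed (use r K in \<open>auto intro!: continuous_intros continuous_on_subset[OF contU]\<close>)
    also have "\<dots> \<le> K * \<Lambda> powr (k * p1)"
      using \<Lambda>(2)[OF k] Jge[of r "k * p1"] K k p r by (intro mult_left_mono) auto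
    also have "\<Lambda> powr (k * p1) = (\<Lambda> powr p1) ^ k"
      using \<Lambda>(1) by (simp add: powr_powr mult.commute flip: powr_realpow)
    finally show ?thesis by (simp add: norm_power)
  qed
  then have bd: "(norm (U w) / \<Lambda> powr p1) ^ k \<le> K" if "(1::nat) \<le> k" for k
    using that \<Lambda>(1) by (simp add: power_divide divide_simps)
  have "1 < norm (U w) / \<Lambda> powr p1" using w \<Lambda>(1) by (simp add: field_simps)
  then obtain n where "K < (norm (U w) / \<Lambda> powr p1) ^ n" using real_arch_pow by blast
  also have "\<dots> \<le> (norm (U w) / \<Lambda> powr p1) ^ Suc n"
    using \<open>1 < _\<close> by (intro power_increasing) auto
  finally show False using bd[of "Suc n"] by simp
qed

text \<open>The sum is at most the maximum of the numbers 2^(n+1) |x n|, because the weights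
  2^-(n+1) add up to at most 1. The constants do not depend on the number of terms, and no triangle
  inequality for p-norms is used.\<close>

lemma powr_norm_sum_le:
  fixes x :: "nat \<Rightarrow> 'a::real_normed_vector"
  assumes "0 < p"
  shows "norm (\<Sum>n<m. x n) powr p \<le> (\<Sum>n<m. 2 powr (real (Suc n) * p) * norm (x n) powr p)"
proof (cases "m = 0")
  case False
  define y where "y n = 2 ^ Suc n * norm (x n)" for n
  define X where "X = Max (y ` {..<m})"
  have "X \<in> y ` {..<m}" unfolding X_def using False by (intro Max_in) auto
  then obtain j where j: "j < m" "X = y j" by auto
  have yX: "y n \<le> X" if "n < m" for n unfolding X_def using that by (intro Max_ge) auto
  have X0: "0 \<le> X" by (simp add: j y_def)
  have geo: "(\<Sum>n<m. (1/2::real) ^ Suc n) \<le> 1" for m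
  proof -
    have "(\<Sum>n<m. (1/2::real) ^ Suc n) = 1 - (1/2) ^ m" by (induction m) auto
    then show ?thesis by simp
  qed
  have "norm (\<Sum>n<m. x n) \<le> (\<Sum>n<m. norm (x n))" by (rule norm_sum)
  also have "\<dots> \<le> (\<Sum>n<m. X * (1/2) ^ Suc n)"
    using yX by (intro sum_mono) (auto simp: y_def field_simps power_divide)
  also have "\<dots> \<le> X" using geo[of m] X0
    by (simp only: sum_distrib_left[symmetric] mult_left_le)
  finally have "norm (\<Sum>n<m. x n) powr p \<le> X powr p" using assms by (intro powr_mono2) auto
  also have "X powr p = 2 powr (real (Suc j) * p) * norm (x j) powr p"
    unfolding j(2) y_def by (simp only: powr_mult powr_realpow[symmetric] powr_powr zero_less_numeral)
  also have "\<dots> \<le> (\<Sum>n<m. 2 powr (real (Suc n) * p) * norm (x n) powr p)"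
    using j(1) by (intro member_le_sum[of j]) auto
  finally show ?thesis .
qed simp

text \<open>\<open>S n\<close> are partial sums of monomials and \<open>R n\<close> are radii
  exhausting the plane. Each hump makes the \<open>p2\<close>-mean large on one circle, and
  \<open>R (Suc n)\<close> is enlarged to contain the image of that circle under \<open>U\<close>,
  so that all later humps are uniformly small there and cannot destroy the gain.\<close>

lemma exists_gliding_hump:
  fixes U :: "complex \<Rightarrow> complex"
  assumes hol: "U holomorphic_on unit_disk" and bm: "\<And>q. 0 < q \<Longrightarrow> bounded_means q U"
    and unb: "\<And>B. \<exists>z\<in>unit_disk. B < norm (U z)"
    and p: "1 \<le> p1" "p1 < p2"
  obtains S :: "nat \<Rightarrow> complex poly" and R :: "nat \<Rightarrow> real" where
    "S 0 = 0" "mono R" "\<And>n. real n \<le> R n"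
    "\<And>n w. norm w \<le> R n \<Longrightarrow> norm (poly (S (Suc n)) w - poly (S n) w) \<le> (1/2) ^ n"
    "\<And>n r. r \<in> {0..<1} \<Longrightarrow>
        circle_mean (\<lambda>z. norm (poly (S (Suc n)) (U z) - poly (S n) (U z)) powr p1) r
          \<le> 2 powr - (real (Suc n) * (p1 + 1))"
    "\<And>n. \<exists>r\<in>{0..<1}. real n < circle_mean (\<lambda>z. norm (poly (S (Suc n)) (U z)) powr p2) r \<and>
        (\<forall>z\<in>sphere 0 r. norm (U z) \<le> R (Suc n))"
proof -
  note contU = holomorphic_on_imp_continuous_on[OF hol]
  have cS: "continuous_on unit_disk (\<lambda>z. poly S (U z))" for S :: "complex poly"
    by (intro continuous_intros contU)
  \<comment> \<open>Bounded \<open>p2\<close>-means of the current sum are part of the invariant, so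
    that it cannot cancel the next hump. The clause on \<open>n = 0\<close> fixes the start, since
    the choice principle only supplies some pair satisfying \<open>P 0\<close>.\<close>
  define P where "P = (\<lambda>(n::nat) (S :: complex poly, R :: real).
    bounded_means p2 (\<lambda>z. poly S (U z)) \<and> 1 \<le> R \<and> real n \<le> R \<and> (n = 0 \<longrightarrow> S = 0))"
  define Q where "Q = (\<lambda>(n::nat) (S :: complex poly, R :: real) (S' :: complex poly, R' :: real).
    R \<le> R' \<and> (\<forall>w. norm w \<le> R \<longrightarrow> norm (poly S' w - poly S w) \<le> (1/2) ^ n) \<and>
    (\<forall>r\<in>{0..<1}. circle_mean (\<lambda>z. norm (poly S' (U z) - poly S (U z)) powr p1) r
          \<le> 2 powr - (real (Suc n) * (p1 + 1))) \<and>
    (\<exists>r\<in>{0..<1}. real n < circle_mean (\<lambda>z. norm (poly S' (U z)) powr p2) r \<and>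
        (\<forall>z\<in>sphere 0 r. norm (U z) \<le> R')))"
  have "\<exists>x. P 0 x"
    by (intro exI[of _ "(0, 1)"]) (auto simp: P_def bounded_means_const)
  moreover have "\<exists>y. P (Suc n) y \<and> Q n x y" if Px: "P n x" for n x
  proof -
    obtain S R where x: "x = (S, R)" by (cases x)
    have SR: "bounded_means p2 (\<lambda>z. poly S (U z))" "1 \<le> R" "real n \<le> R"
      using Px by (auto simp: P_def x)
    obtain B where B: "\<And>r. r \<in> {0..<1} \<Longrightarrow> circle_mean (\<lambda>z. norm (poly S (U z)) powr p2) r \<le> B"
      using SR(1) unfolding bounded_means_def by blast
    have "norm (poly S (U 0)) powr p2 \<le> B" using B[of 0] by simp
    then have B0: "0 \<le> B" by (rule order_trans[OF powr_ge_zero])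
    \<comment> \<open>Against the weight 2^((n+1) p1) from \<open>powr_norm_sum_le\<close> this
      leaves the summable 2^-(n+1); it is also below 2^-n, as needed for uniform
      convergence.\<close>
    define \<epsilon> where "\<epsilon> = 2 powr - (real (Suc n) * (p1 + 1))"
    have e0: "0 < \<epsilon>" by (simp add: \<epsilon>_def)
    have "\<epsilon> \<le> 2 powr - real n"
      unfolding \<epsilon>_def using p mult_mono[of "real n" "real (Suc n)" 1 "p1 + 1"] by (intro powr_mono) auto
    then have en: "\<epsilon> \<le> (1/2) ^ n" by (simp add: powr_minus powr_realpow power_one_over inverse_eq_divide)
    also have "(1/2::real) ^ n \<le> 1" by (simp add: power_le_one)
    finally have e1: "\<epsilon> \<le> 1" .
    \<comment> \<open>By \<open>powr_sum_le\<close>, a hump with \<open>p2\<close>-mean above this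
      value leaves more than \<open>n\<close> after the contribution of the old sum, at most
      \<open>B\<close>, is removed.\<close>
    define L where "L = 2 powr p2 * (real n + B)"
    have L: "0 \<le> L" using B0 by (simp add: L_def)
    obtain c k r where c: "0 < c" "c * R ^ k \<le> \<epsilon>"
      "\<And>r. r \<in> {0..<1} \<Longrightarrow> circle_mean (\<lambda>z. norm (of_real c * U z ^ k) powr p1) r \<le> \<epsilon>"
      and r: "r \<in> {0..<1}" "L < circle_mean (\<lambda>z. norm (of_real c * U z ^ k) powr p2) r"
      using exists_hump[OF hol bm unb p e0 e1 SR(2) L] by blast
    define S' where "S' = S + monom (of_real c) k"
    have dS: "poly S' w - poly S w = of_real c * w ^ k" for w by (simp add: S'_def poly_monom)
    have "compact (U ` sphere 0 r)"
      using r by (intro compact_continuous_image continuous_on_subset[OF contU]) auto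
    then obtain b where b: "\<And>z. z \<in> sphere 0 r \<Longrightarrow> norm (U z) \<le> b"
      using compact_imp_bounded bounded_iff by (metis image_eqI)
    \<comment> \<open>The increment 1 keeps the radii above \<open>n\<close>; \<open>b\<close>
      covers the image of the circle just used.\<close>
    define R' where "R' = max (R + 1) b"
    have cck: "continuous_on unit_disk (\<lambda>z. of_real c * U z ^ k)" by (intro continuous_intros contU)
    have bk: "bounded_means p2 (\<lambda>z. of_real c * U z ^ k)"
    proof (cases "k = 0")
      case False
      show ?thesis
      proof (rule bounded_means_dominated[OF cck contU _ _ bm, of p2 "k * p2" "c powr p2" 0])
        fix z
        show "norm (of_real c * U z ^ k) powr p2 \<le> c powr p2 * norm (U z) powr (real k * p2) + 0"
          using False c by (simp add: norm_mult norm_power powr_mult powr_of_power)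
      qed (use False p in auto)
    qed (simp add: bounded_means_const)
    have bS': "bounded_means p2 (\<lambda>z. poly S' (U z))"
      using bounded_means_add[OF cS[of S] cck _ SR(1) bk] p by (simp add: S'_def poly_monom)
    have "real n < circle_mean (\<lambda>z. norm (poly S' (U z)) powr p2) r"
    proof -
      have cs: "continuous_on (sphere 0 r) (\<lambda>z. norm (poly T (U z)) powr p2)" for T
        using r p by (intro continuous_on_norm_powr cS) auto
      have "L < circle_mean (\<lambda>z. norm (of_real c * U z ^ k) powr p2) r" by (rule r(2))
      also have "\<dots> \<le> circle_mean (\<lambda>z. 2 powr p2 * (norm (poly S' (U z)) powr p2 + norm (poly S (U z)) powr p2)) r"
      proof (intro circle_mean_mono continuous_on_mult_left continuous_on_add continuous_on_const cs continuous_on_norm_powr[OF cck])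
        fix z
        show "norm (of_real c * U z ^ k) powr p2
          \<le> 2 powr p2 * (norm (poly S' (U z)) powr p2 + norm (poly S (U z)) powr p2)"
          using powr_sum_le[of p2 "poly S' (U z)" "- poly S (U z)"] p dS[of "U z"] by simp
      qed (use r p in auto)
      also have "\<dots> = 2 powr p2 * (circle_mean (\<lambda>z. norm (poly S' (U z)) powr p2) r
          + circle_mean (\<lambda>z. norm (poly S (U z)) powr p2) r)"
        using r cs by (simp add: circle_mean_mult circle_mean_add continuous_on_add)
      finally have "real n + B < circle_mean (\<lambda>z. norm (poly S' (U z)) powr p2) r
          + circle_mean (\<lambda>z. norm (poly S (U z)) powr p2) r"
        unfolding L_def by simp
      then show ?thesis using B[OF r(1)] by simp
    qed
    moreover have "norm (poly S' w - poly S w) \<le> (1/2) ^ n" if "norm w \<le> R" for w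
    proof -
      have "norm (poly S' w - poly S w) \<le> c * R ^ k"
        unfolding dS using c that by (simp add: norm_mult norm_power power_mono)
      then show ?thesis using c en by simp
    qed
    ultimately have "P (Suc n) (S', R') \<and> Q n x (S', R')"
      using SR bS' r(1) b c(3) unfolding P_def Q_def x R'_def \<epsilon>_def
      by (auto simp: dS le_max_iff_disj intro!: bexI[of _ r])
    then show ?thesis by blast
  qed
  ultimately obtain f where f: "\<And>n. P n (f n)" "\<And>n. Q n (f n) (f (Suc n))"
    using dependent_nat_choice[of P Q] by blast
  define S where "S = fst \<circ> f"
  define R where "R = snd \<circ> f"
  have fn: "f n = (S n, R n)" for n by (simp add: S_def R_def)
  have "incseq R" using f(2) unfolding fn by (intro incseq_SucI) (auto simp: Q_def)
  show ?thesis
  proof (rule that[of S R])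
    show "S 0 = 0" using f(1)[of 0] by (simp add: fn P_def)
    show "real n \<le> R n" for n using f(1)[of n] by (simp add: fn P_def)
  qed (use f(2) \<open>incseq R\<close> in \<open>auto simp: fn Q_def\<close>)
qed

text \<open>\<open>\<Phi>\<close> is the locally uniform limit of the polynomials
  \<open>S n\<close>. Where \<open>norm w \<le> R n\<close> it differs from \<open>S n\<close> by at
  most 2, so on each circle its means can be compared with those of a suitable polynomial at the
  cost of fixed constants.\<close>

lemma exists_entire_separating:
  fixes U :: "complex \<Rightarrow> complex"
  assumes hol: "U holomorphic_on unit_disk" and bm: "\<And>q. 0 < q \<Longrightarrow> bounded_means q U"
    and unb: "\<And>B. \<exists>z\<in>unit_disk. B < norm (U z)"
    and p: "1 \<le> p1" "p1 < p2"
  obtains \<Phi> where "\<Phi> holomorphic_on UNIV" "bounded_means p1 (\<lambda>z. \<Phi> (U z))"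
    "\<not> bounded_means p2 (\<lambda>z. \<Phi> (U z))"
proof -
  note contU = holomorphic_on_imp_continuous_on[OF hol]
  obtain S :: "nat \<Rightarrow> complex poly" and R :: "nat \<Rightarrow> real" where
    S0: "S 0 = 0" and "mono R" and Rn: "\<And>n. real n \<le> R n"
    and near: "\<And>n w. norm w \<le> R n \<Longrightarrow> norm (poly (S (Suc n)) w - poly (S n) w) \<le> (1/2) ^ n"
    and small: "\<And>n r. r \<in> {0..<1} \<Longrightarrow>
        circle_mean (\<lambda>z. norm (poly (S (Suc n)) (U z) - poly (S n) (U z)) powr p1) r
          \<le> 2 powr - (real (Suc n) * (p1 + 1))"
    and big: "\<And>n. \<exists>r\<in>{0..<1}. real n < circle_mean (\<lambda>z. norm (poly (S (Suc n)) (U z)) powr p2) r \<and>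
        (\<forall>z\<in>sphere 0 r. norm (U z) \<le> R (Suc n))"
    using exists_gliding_hump[OF hol bm unb p] by blast
  have cauchy: "norm (poly (S (n + d)) w - poly (S n) w) \<le> 2 * (1/2) ^ n" if "norm w \<le> R n" for n d w
  proof -
    \<comment> \<open>The exact partial geometric sum is carried along so that the induction
      closes.\<close>
    have "norm (poly (S (n + d)) w - poly (S n) w) \<le> 2 * (1/2) ^ n - 2 * (1/2) ^ (n + d)"
    proof (induction d)
      case (Suc d)
      have "norm w \<le> R (n + d)" using that monoD[OF \<open>mono R\<close>, of n "n + d"] by simp
      from near[OF this] have "norm (poly (S (n + Suc d)) w - poly (S (n + d)) w) \<le> (1/2) ^ (n + d)" by simp
      moreover have "norm (poly (S (n + Suc d)) w - poly (S n) w) \<le>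
        norm (poly (S (n + Suc d)) w - poly (S (n + d)) w) + norm (poly (S (n + d)) w - poly (S n) w)"
        by (metis diff_add_cancel add_diff_eq norm_triangle_ineq)
      ultimately show ?case using Suc by simp
    qed simp
    then show ?thesis by (smt (verit) zero_le_power divide_nonneg_nonneg)
  qed
  define \<Phi> where "\<Phi> w = lim (\<lambda>n. poly (S n) w)" for w
  have conv: "(\<lambda>n. poly (S n) w) \<longlonglongrightarrow> \<Phi> w" for w
  proof -
    obtain m where m: "norm w \<le> real m" using real_arch_simple by blast
    have "Cauchy (\<lambda>n. poly (S n) w)"
    proof (rule metric_CauchyI)
      fix e :: real assume e: "0 < e"
      obtain n0 where "(1/2) ^ n0 < e / 4" using real_arch_pow_inv[of "e/4" "1/2"] e by auto
      moreover have "(1/2::real) ^ max m n0 \<le> (1/2) ^ n0" by (intro power_decreasing) auto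
      ultimately have n: "4 * (1/2) ^ max m n0 < e" by linarith
      have d: "norm (poly (S k) w - poly (S (max m n0)) w) \<le> 2 * (1/2) ^ max m n0" if "max m n0 \<le> k" for k
        using cauchy[of w "max m n0" "k - max m n0"] m Rn[of "max m n0"] that by simp
      have "dist (poly (S k) w) (poly (S l) w) < e" if "max m n0 \<le> k" "max m n0 \<le> l" for k l
        using d[OF that(1)] d[OF that(2)] n
          norm_triangle_ineq4[of "poly (S k) w - poly (S (max m n0)) w" "poly (S l) w - poly (S (max m n0)) w"]
        by (simp add: dist_norm)
      then show "\<exists>M. \<forall>k\<ge>M. \<forall>l\<ge>M. dist (poly (S k) w) (poly (S l) w) < e" by blast
    qed
    then show ?thesis unfolding \<Phi>_def by (simp add: Cauchy_convergent_iff convergent_LIMSEQ_iff)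
  qed
  have tail: "norm (\<Phi> w - poly (S n) w) \<le> 2 * (1/2) ^ n" if "norm w \<le> R n" for n w
  proof -
    have "(\<lambda>d. poly (S (n + d)) w) \<longlonglongrightarrow> \<Phi> w"
      using LIMSEQ_ignore_initial_segment[OF conv[of w], of n] by (simp add: add.commute)
    then have "(\<lambda>d. norm (poly (S (n + d)) w - poly (S n) w)) \<longlonglongrightarrow> norm (\<Phi> w - poly (S n) w)"
      by (intro tendsto_intros)
    then show ?thesis using cauchy[OF that] by (intro tendsto_upperbound) auto
  qed
  have tail2: "norm (\<Phi> w - poly (S n) w) \<le> 2" if "norm w \<le> R n" for n w
    using tail[OF that] power_le_one[of "1/2::real" n] by linarith
  have hol\<Phi>: "\<Phi> holomorphic_on UNIV"
  proof (rule holomorphic_uniform_sequence)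
    show "\<exists>d>0. cball x d \<subseteq> UNIV \<and> uniform_limit (cball x d) (\<lambda>n w. poly (S n) w) \<Phi> sequentially" for x
    proof (intro exI[of _ 1] conjI)
      show "uniform_limit (cball x 1) (\<lambda>n w. poly (S n) w) \<Phi> sequentially"
      proof (rule uniform_limitI)
        fix e :: real assume e: "0 < e"
        obtain n0 where n0: "(1/2) ^ n0 < e / 2" using real_arch_pow_inv[of "e/2" "1/2"] e by auto
        obtain m where m: "norm x + 1 \<le> real m" using real_arch_simple by blast
        have "dist (poly (S n) w) (\<Phi> w) < e" if n: "n \<ge> max m n0" and w: "w \<in> cball x 1" for n w
        proof -
          have "norm w \<le> norm x + 1" using w norm_triangle_ineq2[of w x]
            by (simp add: dist_norm norm_minus_commute)
          then have "norm w \<le> R n" using m Rn[of n] n by linarith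
          from tail[OF this] have "norm (\<Phi> w - poly (S n) w) \<le> 2 * (1/2) ^ n" .
          also have "(1/2::real) ^ n \<le> (1/2) ^ n0" using n by (intro power_decreasing) auto
          finally show ?thesis using n0 by (simp add: dist_norm norm_minus_commute)
        qed
        then show "\<forall>\<^sub>F n in sequentially. \<forall>w\<in>cball x 1. dist (poly (S n) w) (\<Phi> w) < e"
          unfolding eventually_sequentially by blast
      qed
    qed auto
  qed (auto intro!: holomorphic_intros)
  have cS: "continuous_on unit_disk (\<lambda>z. poly T (U z))" for T :: "complex poly"
    by (intro continuous_intros contU)
  have c\<Phi>: "continuous_on unit_disk (\<lambda>z. \<Phi> (U z))"
    using holomorphic_on_imp_continuous_on[OF hol\<Phi>] by (rule continuous_on_compose2[OF _ contU]) auto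
  have "bounded_means p1 (\<lambda>z. \<Phi> (U z))"
  proof -
    have "circle_mean (\<lambda>z. norm (\<Phi> (U z)) powr p1) r \<le> 2 powr p1 * (1 + 2 powr p1)" if r: "r \<in> {0..<1}" for r
    proof -
      have "compact (U ` sphere 0 r)"
        using r by (intro compact_continuous_image continuous_on_subset[OF contU]) auto
      then obtain b where b: "\<And>z. z \<in> sphere 0 r \<Longrightarrow> norm (U z) \<le> b"
        using compact_imp_bounded bounded_iff by (metis image_eqI)
      \<comment> \<open>The index depends on the circle, but the bound 1 obtained for the
        \<open>p1\<close>-mean of \<open>S m\<close> along \<open>U\<close> depends on
        neither.\<close>
      obtain m where m: "b \<le> real m" using real_arch_simple by blast
      have cd: "continuous_on (sphere 0 r) (\<lambda>z. norm (poly (S (Suc n)) (U z) - poly (S n) (U z)) powr p1)" for n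
        using r p by (intro continuous_on_norm_powr continuous_intros cS) auto
      have cm: "continuous_on (sphere 0 r) (\<lambda>z. norm (poly (S m) (U z)) powr p1)"
        using r p by (intro continuous_on_norm_powr cS) auto
      have "circle_mean (\<lambda>z. norm (poly (S m) (U z)) powr p1) r
        \<le> circle_mean (\<lambda>z. \<Sum>n<m. 2 powr (real (Suc n) * p1) * norm (poly (S (Suc n)) (U z) - poly (S n) (U z)) powr p1) r"
      proof (intro circle_mean_mono cm continuous_on_sum continuous_on_mult_left cd)
        fix z
        have "poly (S m) (U z) = (\<Sum>n<m. poly (S (Suc n)) (U z) - poly (S n) (U z))"
          using sum_lessThan_telescope[of "\<lambda>n. poly (S n) (U z)" m] by (simp add: S0)
        then show "norm (poly (S m) (U z)) powr p1
          \<le> (\<Sum>n<m. 2 powr (real (Suc n) * p1) * norm (poly (S (Suc n)) (U z) - poly (S n) (U z)) powr p1)"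
          using powr_norm_sum_le[of p1 "\<lambda>n. poly (S (Suc n)) (U z) - poly (S n) (U z)" m] p by simp
      qed (use r in auto)
      also have "\<dots> = (\<Sum>n<m. 2 powr (real (Suc n) * p1)
          * circle_mean (\<lambda>z. norm (poly (S (Suc n)) (U z) - poly (S n) (U z)) powr p1) r)"
        using r by (subst circle_mean_sum) (auto intro!: sum.cong circle_mean_mult cd continuous_on_mult_left)
      also have "\<dots> \<le> (\<Sum>n<m. 2 powr (real (Suc n) * p1) * 2 powr - (real (Suc n) * (p1 + 1)))"
        by (intro sum_mono mult_left_mono small r) auto
      also have "\<dots> = (\<Sum>n<m. (1/2) ^ Suc n)"
      proof (rule sum.cong)
        fix n
        have "real (Suc n) * p1 + - (real (Suc n) * (p1 + 1)) = - real (Suc n)" by (simp add: algebra_simps)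
        then show "2 powr (real (Suc n) * p1) * 2 powr - (real (Suc n) * (p1 + 1)) = (1/2::real) ^ Suc n"
          unfolding powr_add[symmetric]
          by (simp only: powr_minus powr_realpow zero_less_numeral power_one_over inverse_eq_divide)
      qed simp
      also have "\<dots> = 1 - (1/2) ^ m" by (induction m) auto
      finally have Sm: "circle_mean (\<lambda>z. norm (poly (S m) (U z)) powr p1) r \<le> 1"
        by (smt (verit) zero_le_power divide_nonneg_nonneg)
      have "circle_mean (\<lambda>z. norm (\<Phi> (U z)) powr p1) r
        \<le> circle_mean (\<lambda>z. 2 powr p1 * (norm (poly (S m) (U z)) powr p1 + 2 powr p1)) r"
      proof (intro circle_mean_mono continuous_on_mult_left continuous_on_add continuous_on_const cm continuous_on_norm_powr c\<Phi>)
        fix z :: complex assume "z \<in> sphere 0 r"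
        then have "norm (U z) \<le> R m" using b m Rn[of m] by (meson order_trans)
        then have "norm (\<Phi> (U z) - poly (S m) (U z)) powr p1 \<le> 2 powr p1"
          using p by (intro powr_mono2 tail2) auto
        then show "norm (\<Phi> (U z)) powr p1 \<le> 2 powr p1 * (norm (poly (S m) (U z)) powr p1 + 2 powr p1)"
          using powr_sum_le[of p1 "poly (S m) (U z)" "\<Phi> (U z) - poly (S m) (U z)"] p
          by (smt (verit) add.commute diff_add_cancel mult_left_mono powr_ge_zero)
      qed (use r p in auto)
      also have "\<dots> = 2 powr p1 * (circle_mean (\<lambda>z. norm (poly (S m) (U z)) powr p1) r + 2 powr p1)"
        using r cm by (simp add: circle_mean_mult circle_mean_add continuous_on_add)
      finally show ?thesis using Sm by (smt (verit) mult_left_mono powr_ge_zero)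
    qed
    then show ?thesis unfolding bounded_means_def by blast
  qed
  moreover have "\<not> bounded_means p2 (\<lambda>z. \<Phi> (U z))"
  proof
    assume "bounded_means p2 (\<lambda>z. \<Phi> (U z))"
    then obtain B where B: "\<And>r. r \<in> {0..<1} \<Longrightarrow> circle_mean (\<lambda>z. norm (\<Phi> (U z)) powr p2) r \<le> B"
      unfolding bounded_means_def by blast
    obtain n where n: "2 powr p2 * (B + 2 powr p2) \<le> real n" using real_arch_simple by blast
    obtain r where r: "r \<in> {0..<1}" "real n < circle_mean (\<lambda>z. norm (poly (S (Suc n)) (U z)) powr p2) r"
      "\<And>z. z \<in> sphere 0 r \<Longrightarrow> norm (U z) \<le> R (Suc n)"
      using big[of n] by blast
    have cm: "continuous_on (sphere 0 r) (\<lambda>z. norm (\<Phi> (U z)) powr p2)"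
      using r p by (intro continuous_on_norm_powr c\<Phi>) auto
    have "circle_mean (\<lambda>z. norm (poly (S (Suc n)) (U z)) powr p2) r
        \<le> circle_mean (\<lambda>z. 2 powr p2 * (norm (\<Phi> (U z)) powr p2 + 2 powr p2)) r"
    proof (intro circle_mean_mono continuous_on_mult_left continuous_on_add continuous_on_const cm continuous_on_norm_powr cS)
      fix z :: complex assume "z \<in> sphere 0 r"
      then have "norm (poly (S (Suc n)) (U z) - \<Phi> (U z)) powr p2 \<le> 2 powr p2"
        using p r(3) by (subst norm_minus_commute) (intro powr_mono2 tail2, auto)
      then show "norm (poly (S (Suc n)) (U z)) powr p2 \<le> 2 powr p2 * (norm (\<Phi> (U z)) powr p2 + 2 powr p2)"
        using powr_sum_le[of p2 "\<Phi> (U z)" "poly (S (Suc n)) (U z) - \<Phi> (U z)"] p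
        by (smt (verit) add.commute diff_add_cancel mult_left_mono powr_ge_zero)
    qed (use r p in auto)
    also have "\<dots> = 2 powr p2 * (circle_mean (\<lambda>z. norm (\<Phi> (U z)) powr p2) r + 2 powr p2)"
      using r cm by (simp add: circle_mean_mult circle_mean_add continuous_on_add)
    also have "\<dots> \<le> 2 powr p2 * (B + 2 powr p2)" using B[OF r(1)] by simp
    finally show False using r(2) n by simp
  qed
  ultimately show ?thesis using that hol\<Phi> by blast
qed

section \<open>Functions separating the optimal domains\<close>

lemma volterra_primitive:
  assumes "\<And>z. z \<in> unit_disk \<Longrightarrow> (F has_field_derivative f z * deriv g z) (at z)" "z \<in> unit_disk"
  shows "volterra g f z = F z - F 0"
proof -
  have "((\<lambda>\<zeta>. f \<zeta> * deriv g \<zeta>) has_contour_integral F (pathfinish (linepath 0 z)) - F (pathstart (linepath 0 z)))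
    (linepath 0 z)"
  proof (rule contour_integral_primitive)
    show "path_image (linepath 0 z) \<subseteq> unit_disk"
      using assms(2) closed_segment_subset[of 0 unit_disk z] by simp
    show "(F has_field_derivative f x * deriv g x) (at x within unit_disk)" if "x \<in> unit_disk" for x
      using assms(1)[OF that] by (rule has_field_derivative_at_within)
  qed (rule valid_path_linepath)
  then show ?thesis unfolding volterra_def by (simp add: contour_integral_unique)
qed

lemma optimal_domain_hardy_iff:
  assumes "f holomorphic_on unit_disk" "0 < p"
    and "\<And>z. z \<in> unit_disk \<Longrightarrow> (F has_field_derivative f z * deriv g z) (at z)"
  shows "f \<in> optimal_domain (volterra g) (hardy_space p) \<longleftrightarrow> bounded_means p F"
proof -
  have F: "F holomorphic_on unit_disk"
    unfolding holomorphic_on_open[OF open_ball] using assms(3) by blast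
  note cF = holomorphic_on_imp_continuous_on[OF F]
  note v = volterra_primitive[of F f g, OF assms(3)]
  have "bounded_means p (volterra g f) \<longleftrightarrow> bounded_means p (\<lambda>z. F z - F 0)"
  proof -
    have "circle_mean (\<lambda>z. norm (volterra g f z) powr p) r = circle_mean (\<lambda>z. norm (F z - F 0) powr p) r"
      if "r \<in> {0..<1}" for r
      using that v by (intro circle_mean_cong) auto
    then show ?thesis unfolding bounded_means_def by (metis (no_types, lifting))
  qed
  moreover have "volterra g f holomorphic_on unit_disk \<longleftrightarrow> (\<lambda>z. F z - F 0) holomorphic_on unit_disk"
    by (intro holomorphic_cong v) auto
  ultimately show ?thesis
    using assms(1) F unfolding optimal_domain_def hardy_space_iff[OF assms(2)]
    by (auto simp: bounded_means_diff_const[OF cF assms(2)] intro!: holomorphic_intros)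
qed

text \<open>The square root of a function with values in the right half-plane has argument at most
  pi/4 in modulus, so its modulus is at most sqrt 2 times its real part. The real part is harmonic,
  hence its means equal its value at 0.\<close>

lemma bounded_means_half:
  assumes hol: "U holomorphic_on unit_disk" and pos: "\<And>z. z \<in> unit_disk \<Longrightarrow> 0 < Re (U z)"
  shows "bounded_means (1/2) U"
proof -
  define s where "s z = csqrt (U z)" for z
  have nonpos: "U z \<notin> \<real>\<^sub>\<le>\<^sub>0" if "z \<in> unit_disk" for z
    using pos[OF that] by (auto simp: complex_nonpos_Reals_iff)
  have hs: "s holomorphic_on unit_disk" unfolding s_def
    using nonpos by (intro holomorphic_on_csqrt' hol) auto
  note cs = holomorphic_on_imp_continuous_on[OF hs]
  have le: "norm (U z) powr (1/2) \<le> sqrt 2 * Re (s z)" if "z \<in> unit_disk" for z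
  proof -
    have U: "U z = (s z)\<^sup>2" by (simp add: s_def)
    have "0 < (Re (s z))\<^sup>2 - (Im (s z))\<^sup>2" using pos[OF that] unfolding U by (simp add: power2_eq_square)
    then have "(norm (s z))\<^sup>2 \<le> 2 * (Re (s z))\<^sup>2" by (simp add: cmod_power2)
    also have "\<dots> = (sqrt 2 * Re (s z))\<^sup>2" by (simp add: power_mult_distrib)
    finally have "norm (s z) \<le> sqrt 2 * Re (s z)"
      by (rule power2_le_imp_le) (intro mult_nonneg_nonneg, simp, unfold s_def, rule Re_csqrt)
    moreover have "norm (U z) powr (1/2) = norm (s z)"
      by (simp add: U norm_power powr_half_sqrt)
    ultimately show ?thesis by simp
  qed
  have "circle_mean (\<lambda>z. norm (U z) powr (1/2)) r \<le> sqrt 2 * Re (s 0)" if r: "r \<in> {0..<1}" for r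
  \<comment> \<open>The mean value property is available for positive radii only.\<close>
  proof (cases "r = 0")
    case True
    then show ?thesis using le[of 0] by simp
  next
    case False
    have cr: "continuous_on (sphere 0 r) s" using r by (intro continuous_on_subset[OF cs]) auto
    have "circle_mean (\<lambda>z. norm (U z) powr (1/2)) r \<le> circle_mean (\<lambda>z. sqrt 2 * Re (s z)) r"
      using r by (intro circle_mean_mono continuous_on_norm_powr continuous_on_mult_left
          continuous_on_Re cr holomorphic_on_imp_continuous_on[OF hol] le) auto
    also have "\<dots> = sqrt 2 * Re (circle_mean s r)"
      using r by (simp add: circle_mean_mult circle_mean_Re cr continuous_on_Re)
    also have "circle_mean s r = s 0"
      using r False by (intro circle_mean_holomorphic continuous_on_subset[OF cs] holomorphic_on_subset[OF hs]) auto
    finally show ?thesis .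
  qed
  then show ?thesis unfolding bounded_means_def by blast
qed

text \<open>\<open>V\<close> records that the derivative of \<open>U\<close> is a holomorphic
  multiple of that of \<open>g\<close>. By the chain rule the same holds for
  \<open>\<Phi> \<circ> U\<close>, with multiplier \<open>deriv \<Phi> (U z) * V z\<close>.\<close>

lemma separating_function_entire:
  assumes hol: "U holomorphic_on unit_disk" "V holomorphic_on unit_disk"
    and der: "\<And>z. z \<in> unit_disk \<Longrightarrow> (U has_field_derivative V z * deriv g z) (at z)"
    and bm: "\<And>q. 0 < q \<Longrightarrow> bounded_means q U"
    and unb: "\<And>B. \<exists>z\<in>unit_disk. B < norm (U z)"
    and p: "1 \<le> p1" "p1 < p2"
  obtains f where "f \<in> optimal_domain (volterra g) (hardy_space p1)"
    "f \<notin> optimal_domain (volterra g) (hardy_space p2)"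
proof -
  obtain \<Phi> where \<Phi>: "\<Phi> holomorphic_on UNIV" "bounded_means p1 (\<lambda>z. \<Phi> (U z))"
    "\<not> bounded_means p2 (\<lambda>z. \<Phi> (U z))"
    using exists_entire_separating[OF hol(1) bm unb p] by blast
  define f where "f z = deriv \<Phi> (U z) * V z" for z
  have "(\<lambda>z. deriv \<Phi> (U z)) holomorphic_on unit_disk"
    using holomorphic_on_compose_gen[OF hol(1) holomorphic_deriv[OF \<Phi>(1)]] by (simp add: o_def)
  then have f: "f holomorphic_on unit_disk" unfolding f_def by (intro holomorphic_intros hol)
  have F: "((\<lambda>z. \<Phi> (U z)) has_field_derivative f z * deriv g z) (at z)" if "z \<in> unit_disk" for z
    unfolding f_def mult.assoc
    using DERIV_chain2[OF holomorphic_derivI[OF \<Phi>(1), of "U z"] der[OF that]] by simp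
  show ?thesis
    using \<Phi>(2,3) p by (intro that[of f]; subst optimal_domain_hardy_iff[OF f _ F]) auto
qed

text \<open>A power of \<open>U\<close> with exponent \<beta> has bounded q-means exactly when
  \<open>U\<close> has bounded (\<beta> q)-means. The admissible exponents of \<open>U\<close> are
  closed downwards, so if they are bounded, rescaling moves their supremum strictly between
  \<open>p1\<close> and \<open>p2\<close>.\<close>

lemma separating_function_power:
  assumes hol: "U holomorphic_on unit_disk" "V holomorphic_on unit_disk"
    and der: "\<And>z. z \<in> unit_disk \<Longrightarrow> (U has_field_derivative V z * deriv g z) (at z)"
    and pos: "\<And>z. z \<in> unit_disk \<Longrightarrow> 0 < Re (U z)"
    and unb: "\<And>B. \<exists>z\<in>unit_disk. B < norm (U z)"
    and p: "1 \<le> p1" "p1 < p2"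
  obtains f where "f \<in> optimal_domain (volterra g) (hardy_space p1)"
    "f \<notin> optimal_domain (volterra g) (hardy_space p2)"
proof -
  note cU = holomorphic_on_imp_continuous_on[OF hol(1)]
  define S where "S = {s. 0 < s \<and> bounded_means s U}"
  have half: "1/2 \<in> S" using bounded_means_half[OF hol(1) pos] by (simp add: S_def)
  show thesis
  proof (cases "bdd_above S")
    case False
    have "bounded_means q U" if "0 < q" for q
    proof -
      obtain s where "s \<in> S" "q < s" using False unfolding bdd_above_def by (meson not_le)
      then show ?thesis using bounded_means_mono[OF cU that, of s] by (simp add: S_def)
    qed
    then show ?thesis using separating_function_entire[OF hol der _ unb p] that by blast
  next
    case True
    define a where "a = Sup S"
    have a: "1/2 \<le> a" unfolding a_def by (rule cSup_upper[OF half True])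
    \<comment> \<open>The critical exponent of the power becomes \<open>a / \<beta>\<close>, the
      midpoint of \<open>p1\<close> and \<open>p2\<close>; whether \<open>a\<close> itself is
      admissible does not matter.\<close>
    define \<beta> where "\<beta> = 2 * a / (p1 + p2)"
    have b: "0 < \<beta>" "\<beta> * p1 < a" "a < \<beta> * p2"
      using a p by (simp_all add: \<beta>_def field_simps)
    have nonpos: "U z \<notin> \<real>\<^sub>\<le>\<^sub>0" if "z \<in> unit_disk" for z
      using pos[OF that] by (auto simp: complex_nonpos_Reals_iff)
    define F where "F z = U z powr of_real \<beta>" for z
    define f where "f z = of_real \<beta> * U z powr (of_real \<beta> - 1) * V z" for z
    have f: "f holomorphic_on unit_disk" unfolding f_def
      using nonpos by (intro holomorphic_intros hol) auto
    have F: "(F has_field_derivative f z * deriv g z) (at z)" if "z \<in> unit_disk" for z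
      unfolding f_def mult.assoc unfolding F_def
      using DERIV_chain2[OF has_field_derivative_powr[OF nonpos[OF that]] der[OF that]]
      by (simp add: mult.assoc)
    have cF: "continuous_on unit_disk F"
      using F by (meson DERIV_continuous continuous_at_imp_continuous_on)
    have nF: "norm (F z) powr q = norm (U z) powr (\<beta> * q)" for z q
      by (simp add: F_def norm_powr_real_powr' powr_powr)
    have bF: "bounded_means q F \<longleftrightarrow> \<beta> * q \<in> S" if "0 < q" for q
      using that b unfolding bounded_means_def nF S_def by simp
    obtain s where s: "s \<in> S" "\<beta> * p1 < s"
      using less_cSupD[of S "\<beta> * p1"] half b(2) unfolding a_def by blast
    have "\<beta> * p1 \<in> S"
      using bounded_means_mono[OF cU, of "\<beta> * p1" s] s b p by (simp add: S_def)
    moreover have "\<beta> * p2 \<notin> S" using cSup_upper[OF _ True, of "\<beta> * p2"] b(3) by (auto simp: a_def)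
    ultimately show ?thesis
      using p bF by (intro that[of f]; subst optimal_domain_hardy_iff[OF f _ F]) auto
  qed
qed

lemma separating_function_exists:
  assumes hol: "g holomorphic_on unit_disk" and nc: "\<not> g constant_on unit_disk"
    and bm: "\<And>q. 0 < q \<Longrightarrow> bounded_means q g"
    and p: "1 \<le> p1" "p1 < p2"
  obtains f where "f \<in> optimal_domain (volterra g) (hardy_space p1)"
    "f \<notin> optimal_domain (volterra g) (hardy_space p2)"
proof (cases "bounded (g ` unit_disk)")
  case False
  have "\<exists>z\<in>unit_disk. B < norm (g z)" for B
    using False unfolding bounded_iff by (auto simp: not_le)
  moreover have "(g has_field_derivative 1 * deriv g z) (at z)" if "z \<in> unit_disk" for z
    using holomorphic_derivI[OF hol open_ball that] by simp
  ultimately show ?thesis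
    using separating_function_entire[OF hol holomorphic_on_const _ bm _ p] that by blast
next
  case True
  have "compact (closure (g ` unit_disk))" using True by (simp add: compact_closure)
  then obtain w where w: "w \<in> closure (g ` unit_disk)"
    "\<And>y. y \<in> closure (g ` unit_disk) \<Longrightarrow> norm y \<le> norm w"
    using continuous_attains_sup[of "closure (g ` unit_disk)" norm]
    by (auto intro: continuous_intros)
  \<comment> \<open>Strictness comes from the maximum modulus principle, and is where
    \<open>g\<close> being non-constant enters.\<close>
  have less: "norm (g z) < norm w" if z: "z \<in> unit_disk" for z
  proof (rule ccontr)
    assume "\<not> norm (g z) < norm w"
    then have "norm (g y) \<le> norm (g z)" if "y \<in> unit_disk" for y
      using w(2)[of "g y"] closure_subset[of "g ` unit_disk"] that by fastforce
    then have "g constant_on unit_disk"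
      using maximum_modulus_principle[OF hol, of unit_disk z] z by (simp add: connected_ball)
    then show False using nc by simp
  qed
  have w0: "w \<noteq> 0" using less[of 0] by auto
  have nw: "w - g z \<noteq> 0" if "z \<in> unit_disk" for z using less[OF that] by auto
  define U where "U z = w / (w - g z)" for z
  define V where "V z = w / (w - g z)\<^sup>2" for z
  have hU: "U holomorphic_on unit_disk" unfolding U_def by (intro holomorphic_intros hol nw)
  have hV: "V holomorphic_on unit_disk" unfolding V_def using nw by (intro holomorphic_intros hol) auto
  have der: "(U has_field_derivative V z * deriv g z) (at z)" if "z \<in> unit_disk" for z
    unfolding U_def V_def using nw[OF that] holomorphic_derivI[OF hol _ that]
    by (auto intro!: derivative_eq_intros simp: power2_eq_square)
  have pos: "0 < Re (U z)" if "z \<in> unit_disk" for z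
  proof -
    have "norm (g z / w) < 1" using less[OF that] w0 by (simp add: norm_divide)
    then have "0 < Re (1 - g z / w)" using complex_Re_le_cmod[of "g z / w"] by simp
    moreover have "U z = inverse (1 - g z / w)" using w0 nw[OF that] by (simp add: U_def field_simps)
    moreover have "0 < Re (inverse x)" if "0 < Re x" for x :: complex
      using that by (simp add: add_pos_nonneg)
    ultimately show ?thesis by metis
  qed
  have unb: "\<exists>z\<in>unit_disk. B < norm (U z)" for B
  proof -
    \<comment> \<open>|U| is |w| divided by the distance of \<open>g z\<close> from
      \<open>w\<close>, so values closer than \<open>e\<close> give |U| above
      \<open>\<bar>B\<bar> + 1\<close>.\<close>
    define e where "e = norm w / (\<bar>B\<bar> + 1)"
    have e: "0 < e" using w0 by (simp add: e_def add_nonneg_pos)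
    obtain z where z: "z \<in> unit_disk" "dist (g z) w < e"
      using w(1) e unfolding closure_approachable by blast
    have d: "0 < norm (w - g z)" using nw[OF z(1)] by simp
    have "norm (w - g z) * (\<bar>B\<bar> + 1) < norm w"
      using z(2) unfolding e_def by (simp add: dist_norm norm_minus_commute pos_less_divide_eq add_nonneg_pos)
    then have "\<bar>B\<bar> + 1 < norm (U z)"
      using d by (simp add: U_def norm_divide pos_less_divide_eq mult.commute)
    then show ?thesis using z(1) by force
  qed
  show ?thesis using separating_function_power[OF hU hV der pos unb p] that by blast
qed

lemma optimal_domain_mono:
  assumes "g holomorphic_on unit_disk" "0 < p" "p \<le> q"
  shows "optimal_domain (volterra g) (hardy_space q) \<subseteq> optimal_domain (volterra g) (hardy_space p)"
  using assms bounded_means_mono[OF holomorphic_on_imp_continuous_on assms(2,3)]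
  by (auto simp: optimal_domain_def hardy_space_iff)

section \<open>Dilated BMOA functions\<close>

lemma polynomial_approximation:
  assumes "G holomorphic_on ball 0 R" "1 < R" "0 < \<epsilon>"
  obtains T :: "complex poly" where "\<And>z. norm z \<le> 1 \<Longrightarrow> norm (G z - poly T z) < \<epsilon>"
proof -
  define a where "a n = (deriv ^^ n) G 0 / fact n" for n
  have sums: "(\<lambda>n. a n * z ^ n) sums G z" if "norm z < R" for z
    using holomorphic_power_series[OF assms(1), of z] that by (simp add: a_def)
  obtain \<rho> where \<rho>: "1 < \<rho>" "\<rho> < R" using assms(2) dense by blast
  have "summable (\<lambda>n. a n * of_real \<rho> ^ n)"
    using sums[of "of_real \<rho>"] \<rho> by (auto intro: sums_summable)
  then have "ereal \<rho> \<le> conv_radius a" using conv_radius_geI[of a "of_real \<rho>"] \<rho> by simp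
  then have "ereal 1 < conv_radius a" using \<rho>(1) by (metis ereal_less_eq(3) less_le_trans less_ereal.simps(1))
  from powser_uniform_limit[OF this, of 0]
  have "\<forall>\<^sub>F n in sequentially. \<forall>z\<in>cball 0 1. dist (\<Sum>i<n. a i * z ^ i) (\<Sum>i. a i * z ^ i) < \<epsilon>"
    using assms(3) by (auto dest!: uniform_limitD)
  then obtain n where n: "\<And>z. z \<in> cball 0 1 \<Longrightarrow> dist (\<Sum>i<n. a i * z ^ i) (\<Sum>i. a i * z ^ i) < \<epsilon>"
    unfolding eventually_sequentially by blast
  show thesis
  proof (rule that[of "\<Sum>i<n. monom (a i) i"])
    fix z :: complex assume z: "norm z \<le> 1"
    then have "(\<Sum>i. a i * z ^ i) = G z" using sums[of z] assms(2) by (auto intro: sums_unique[symmetric])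
    then show "norm (G z - poly (\<Sum>i<n. monom (a i) i) z) < \<epsilon>"
      using n[of z] z by (simp add: poly_sum poly_monom dist_norm norm_minus_commute)
  qed
qed

text \<open>On the unit circle conjugation inverts \<open>z\<close>, so |T|^2 is a trigonometric
  polynomial, and Re H is its Poisson extension to the disk.\<close>

lemma harmonic_majorant_poly:
  fixes T :: "complex poly"
  obtains H :: "complex poly" where "\<And>z. norm z = 1 \<Longrightarrow> Re (poly H z) = (norm (poly T z))\<^sup>2"
proof -
  define a where "a = coeff T"
  define n where "n = degree T"
  \<comment> \<open>Of the term with indices \<open>j\<close>, \<open>k\<close> and its conjugate,
    the one that reduces to a nonnegative power of \<open>z\<close> is taken; their real parts
    agree.\<close>
  define h where "h j k = (if k \<le> j then monom (a j * cnj (a k)) (j - k) else monom (cnj (a j) * a k) (k - j))" for j k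
  have h: "Re (poly (h j k) z) = Re (a j * z ^ j * cnj (a k * z ^ k))" if z: "norm z = 1" for j k z
  proof -
    have zz: "z * cnj z = 1" using z by (simp add: complex_norm_square[symmetric])
    have zn: "z ^ m * cnj z ^ m = 1" for m using zz by (simp flip: power_mult_distrib)
    have red: "x ^ j * y ^ k = x ^ (j - k)" if "k \<le> j" "\<And>m. x ^ m * y ^ m = 1" for x y :: complex and j k
    proof -
      have "x ^ j * y ^ k = x ^ (j - k) * (x ^ k * y ^ k)"
        using that(1) by (simp add: mult.assoc[symmetric] power_add[symmetric])
      then show ?thesis using that(2) by simp
    qed
    show ?thesis
    proof (cases "k \<le> j")
      case True
      have "a j * z ^ j * cnj (a k * z ^ k) = a j * cnj (a k) * (z ^ j * cnj z ^ k)" by simp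
      also have "\<dots> = poly (h j k) z" using True red[OF True, of z "cnj z"] zn by (simp add: h_def poly_monom)
      finally show ?thesis by simp
    next
      case False
      then have "j \<le> k" by simp
      have "cnj (a j * z ^ j * cnj (a k * z ^ k)) = cnj (a j) * a k * (z ^ k * cnj z ^ j)" by simp
      also have "\<dots> = poly (h j k) z" using False red[OF \<open>j \<le> k\<close>, of z "cnj z"] zn by (simp add: h_def poly_monom)
      finally show ?thesis by (metis complex_cnj(1) cnj.simps(1))
    qed
  qed
  show thesis
  proof (rule that[of "\<Sum>j\<le>n. \<Sum>k\<le>n. h j k"])
    fix z :: complex assume z: "norm z = 1"
    have "poly T z * cnj (poly T z) = (\<Sum>j\<le>n. \<Sum>k\<le>n. a j * z ^ j * cnj (a k * z ^ k))"
      by (simp add: poly_altdef a_def n_def cnj_sum sum_product)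
    then have "Re (poly T z * cnj (poly T z)) = (\<Sum>j\<le>n. \<Sum>k\<le>n. Re (poly (h j k) z))"
      by (simp only: Re_sum h[OF z])
    moreover have "Re (poly T z * cnj (poly T z)) = (norm (poly T z))\<^sup>2"
      by (simp add: complex_norm_square[symmetric])
    ultimately show "Re (poly (\<Sum>j\<le>n. \<Sum>k\<le>n. h j k) z) = (norm (poly T z))\<^sup>2"
      by (simp add: poly_sum)
  qed
qed

section \<open>Disk involutions and the mean oscillation of a polynomial\<close>

lemma disk_involution_denom:
  assumes "norm a < 1" "norm z \<le> 1"
  shows "1 - cnj a * z \<noteq> 0"
proof
  assume "1 - cnj a * z = 0"
  then have "norm (cnj a * z) = 1" by (metis eq_iff_diff_eq_0 norm_one)
  moreover have "norm (cnj a * z) \<le> norm a * 1" unfolding norm_mult using assms by (intro mult_mono) auto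
  ultimately show False using assms by simp
qed

lemma disk_involution_holomorphic:
  assumes "norm a < 1"
  shows "disk_involution a holomorphic_on ball 0 1"
proof -
  have "(\<lambda>z. (a - z) / (1 - cnj a * z)) holomorphic_on ball 0 1"
    using disk_involution_denom[OF assms] by (intro holomorphic_intros) auto
  then show ?thesis by (simp add: disk_involution_def[abs_def])
qed

lemma disk_involution_continuous:
  assumes "norm a < 1"
  shows "continuous_on (cball 0 1) (disk_involution a)"
proof -
  have "continuous_on (cball 0 1) (\<lambda>z. (a - z) / (1 - cnj a * z))"
    using disk_involution_denom[OF assms] by (intro continuous_intros) auto
  then show ?thesis by (simp add: disk_involution_def[abs_def])
qed

lemma disk_involution_norm_eq:
  assumes "norm a < 1" "norm z = 1"
  shows "norm (disk_involution a z) = 1"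
proof -
  have "z * cnj z = 1" using assms(2) by (simp add: complex_norm_square[symmetric])
  then have "1 - cnj a * z = z * cnj (z - a)" by (simp add: algebra_simps)
  then have "norm (1 - cnj a * z) = norm (a - z)"
    using assms(2) by (simp only: norm_mult complex_mod_cnj norm_minus_commute)
  then show ?thesis using disk_involution_denom[of a z] assms by (auto simp: disk_involution_def norm_divide)
qed

lemma disk_involution_norm_less:
  assumes "norm a < 1" "norm z < 1"
  shows "norm (disk_involution a z) < 1"
proof -
  have "norm (Moebius_function 0 a z) < 1" by (rule Moebius_function_norm_lt_1[OF assms])
  moreover have "disk_involution a z = - Moebius_function 0 a z"
    by (simp add: disk_involution_def Moebius_function_def minus_divide_left)
  ultimately show ?thesis by simp
qed

lemma disk_involution_norm_le:
  assumes "norm a < 1" "norm z \<le> 1"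
  shows "norm (disk_involution a z) \<le> 1"
  using disk_involution_norm_eq[OF assms(1), of z] disk_involution_norm_less[OF assms(1), of z] assms(2)
  by (cases "norm z = 1") auto

lemma disk_involution_involution:
  assumes "norm a < 1" "norm z < 1"
  shows "disk_involution a (disk_involution a z) = z"
proof -
  have d: "1 - cnj a * z \<noteq> 0" "1 - cnj a * a \<noteq> 0" using disk_involution_denom[OF assms(1)] assms by auto
  have "a - (a - z) / (1 - cnj a * z) = z * (1 - cnj a * a) / (1 - cnj a * z)"
    using d by (simp add: field_simps)
  moreover have "1 - cnj a * ((a - z) / (1 - cnj a * z)) = (1 - cnj a * a) / (1 - cnj a * z)"
    using d by (simp add: field_simps)
  ultimately show ?thesis using d by (simp add: disk_involution_def)
qed

text \<open>The involution preserves the unit circle, where |T|^2 = Re H. Expanding the square there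
  gives the real part of a holomorphic function, whose mean is its value at 0; and the involution
  sends 0 to \<open>a\<close>.\<close>

lemma harmonic_majorant_defect:
  fixes T H :: "complex poly"
  assumes H: "\<And>z. norm z = 1 \<Longrightarrow> Re (poly H z) = (norm (poly T z))\<^sup>2" and a: "norm a < 1"
  shows "circle_mean (\<lambda>z. (norm (poly T (disk_involution a z) - poly T a))\<^sup>2) 1
    = Re (poly H a) - (norm (poly T a))\<^sup>2"
proof -
  define K where "K z = poly H (disk_involution a z) - 2 * cnj (poly T a) * poly T (disk_involution a z)
    + of_real ((norm (poly T a))\<^sup>2)" for z
  have cK: "continuous_on (cball 0 1) K" unfolding K_def
    by (intro continuous_intros disk_involution_continuous a)
  have hp: "(\<lambda>z. poly p (disk_involution a z)) holomorphic_on ball 0 1" for p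
    by (intro holomorphic_intros disk_involution_holomorphic a)
  have hK: "K holomorphic_on ball 0 1" unfolding K_def by (intro holomorphic_intros hp)
  have "circle_mean (\<lambda>z. (norm (poly T (disk_involution a z) - poly T a))\<^sup>2) 1 = circle_mean (\<lambda>z. Re (K z)) 1"
  proof (rule circle_mean_cong)
    fix z :: complex assume "z \<in> sphere 0 1"
    then have "norm (disk_involution a z) = 1" using disk_involution_norm_eq[OF a] by simp
    moreover have "(norm (x - y))\<^sup>2 = (norm x)\<^sup>2 - Re (2 * cnj y * x) + (norm y)\<^sup>2" for x y :: complex
      unfolding cmod_power2 by (simp add: power2_eq_square algebra_simps)
    ultimately show "(norm (poly T (disk_involution a z) - poly T a))\<^sup>2 = Re (K z)"
      using H by (simp add: K_def)
  qed simp
  also have "\<dots> = Re (circle_mean K 1)"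
    by (intro circle_mean_Re continuous_on_subset[OF cK]) auto
  also have "circle_mean K 1 = K 0" by (rule circle_mean_holomorphic[OF cK hK]) simp
  also have "Re (K 0) = Re (poly H a) - (norm (poly T a))\<^sup>2"
    unfolding K_def disk_involution_def cmod_power2 by (simp add: power2_eq_square algebra_simps)
  finally show ?thesis .
qed

text \<open>Inside the disk the difference is a mean of squares, by the previous identity; on the
  circle both sides agree.\<close>

lemma harmonic_majorant_ge:
  fixes T H :: "complex poly"
  assumes H: "\<And>z. norm z = 1 \<Longrightarrow> Re (poly H z) = (norm (poly T z))\<^sup>2" and a: "norm a \<le> 1"
  shows "(norm (poly T a))\<^sup>2 \<le> Re (poly H a)"
proof (cases "norm a = 1")
  case False
  then have a': "norm a < 1" using a by simp
  have "0 \<le> circle_mean (\<lambda>z. (norm (poly T (disk_involution a z) - poly T a))\<^sup>2) 1"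
    by (intro circle_mean_nonneg continuous_intros continuous_on_subset[OF disk_involution_continuous[OF a']]) auto
  then show ?thesis using harmonic_majorant_defect[OF H a'] by simp
qed (simp add: H)

lemma norm_diff_square_le:
  fixes x y :: "'a::real_normed_vector"
  assumes "norm (x - y) \<le> e"
  shows "(norm x)\<^sup>2 \<le> 2 * (norm y)\<^sup>2 + 2 * e\<^sup>2"
proof -
  have "norm x \<le> norm y + e" using assms norm_triangle_sub[of x y] by linarith
  then have "(norm x)\<^sup>2 \<le> (norm y + e)\<^sup>2" by (intro power_mono) auto
  also have "\<dots> \<le> 2 * (norm y)\<^sup>2 + 2 * e\<^sup>2"
    using zero_le_power2[of "norm y - e"] by (simp add: power2_eq_square algebra_simps)
  finally show ?thesis .
qed

lemma circle_mean_dilate: "circle_mean (\<lambda>z. F (of_real s * z)) 1 = circle_mean F s"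
  by (simp add: circle_mean_def)

text \<open>A lossy form of Littlewood's subordination principle: replacing \<open>G\<close> by a polynomial costs
  the constants, but makes the harmonic majorant on the circle a finite sum.\<close>
lemma subordination:
  assumes hG: "G holomorphic_on unit_disk" and M: "\<And>r. r \<in> {0..<1} \<Longrightarrow> circle_mean (\<lambda>z. (norm (G z))\<^sup>2) r \<le> M"
    and w: "continuous_on (cball 0 1) \<omega>" "\<omega> holomorphic_on ball 0 1" "\<omega> 0 = 0"
    and w1: "\<And>z. norm z \<le> 1 \<Longrightarrow> norm (\<omega> z) < 1"
  shows "circle_mean (\<lambda>z. (norm (G (\<omega> z)))\<^sup>2) 1 \<le> 4 * M + 6"
proof -
  obtain x where x: "norm x \<le> 1" "\<And>z. norm z \<le> 1 \<Longrightarrow> norm (\<omega> z) \<le> norm (\<omega> x)"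
    using continuous_attains_sup[OF compact_cball _ continuous_on_norm[OF w(1)]] by auto
  \<comment> \<open>By compactness \<open>\<omega>\<close> stays at distance from the circle.
    Dividing by \<open>s\<close> keeps its values in the closed disk, while G(s z) becomes
    holomorphic beyond that disk and can be approximated there.\<close>
  define s where "s = (norm (\<omega> x) + 1) / 2"
  have s: "0 < s" "s < 1" "norm (\<omega> x) \<le> s" using w1[OF x(1)] by (auto simp: s_def add_nonneg_pos)
  have ws: "norm (\<omega> z / of_real s) \<le> 1" if "norm z \<le> 1" for z
    using x(2)[OF that] s by (simp add: norm_divide)
  have "(\<lambda>z. G (of_real s * z)) holomorphic_on ball 0 (1 / s)"
    using s by (intro holomorphic_on_compose_gen[OF _ hG, of "(*) (of_real s)", unfolded o_def] holomorphic_intros)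
      (auto simp: norm_mult field_simps)
  then obtain T where T: "\<And>z. norm z \<le> 1 \<Longrightarrow> norm (G (of_real s * z) - poly T z) < 1"
    using polynomial_approximation[of "\<lambda>z. G (of_real s * z)" "1/s" 1] s by auto
  obtain H where H: "\<And>z. norm z = 1 \<Longrightarrow> Re (poly H z) = (norm (poly T z))\<^sup>2"
    using harmonic_majorant_poly by blast
  have cG: "continuous_on (sphere 0 s) (\<lambda>z. (norm (G z))\<^sup>2)"
    using s by (intro continuous_intros continuous_on_subset[OF holomorphic_on_imp_continuous_on[OF hG]]) auto
  have cGs: "continuous_on (sphere 0 1) (\<lambda>z. (norm (G (of_real s * z)))\<^sup>2)"
    using s by (intro continuous_on_compose2[OF cG] continuous_intros) (auto simp: norm_mult)
  have "Re (poly H 0) = circle_mean (\<lambda>z. Re (poly H z)) 1"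
  proof -
    have cH: "continuous_on A (poly H)" for A by (intro continuous_intros)
    have hH: "(\<lambda>z. poly H z) holomorphic_on A" for A by (intro holomorphic_intros)
    show ?thesis using circle_mean_holomorphic[OF cH hH, of 1] by (simp add: circle_mean_Re cH)
  qed
  also have "\<dots> = circle_mean (\<lambda>z. (norm (poly T z))\<^sup>2) 1"
    by (intro circle_mean_cong H) auto
  also have "\<dots> \<le> circle_mean (\<lambda>z. 2 * (norm (G (of_real s * z)))\<^sup>2 + 2 * 1\<^sup>2) 1"
  proof (intro circle_mean_mono continuous_on_add continuous_on_mult_left cGs)
    fix z :: complex assume "z \<in> sphere 0 1"
    then show "(norm (poly T z))\<^sup>2 \<le> 2 * (norm (G (of_real s * z)))\<^sup>2 + 2 * 1\<^sup>2"
      using T[of z] by (intro norm_diff_square_le) (auto simp: norm_minus_commute)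
  qed (auto intro!: continuous_intros)
  also have "\<dots> = 2 * circle_mean (\<lambda>z. (norm (G z))\<^sup>2) s + 2"
    using circle_mean_dilate[of "\<lambda>z. (norm (G z))\<^sup>2" s] cGs
    by (simp add: circle_mean_add circle_mean_mult continuous_on_mult_left)
  finally have H0: "Re (poly H 0) \<le> 2 * M + 2" using M[of s] s by simp
  have c\<omega>: "continuous_on (cball 0 1) (\<lambda>z. poly H (\<omega> z / of_real s))"
    using s by (intro continuous_intros w) auto
  have h\<omega>: "(\<lambda>z. poly H (\<omega> z / of_real s)) holomorphic_on ball 0 1"
    using s by (intro holomorphic_on_compose_gen[of "\<lambda>z. \<omega> z / of_real s" _ "poly H" UNIV, unfolded o_def] holomorphic_intros w) auto
  have c1: "continuous_on (sphere 0 1) (\<lambda>z. Re (poly H (\<omega> z / of_real s)))"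
    by (intro continuous_intros continuous_on_subset[OF c\<omega>]) auto
  have "circle_mean (\<lambda>z. (norm (G (\<omega> z)))\<^sup>2) 1 \<le> circle_mean (\<lambda>z. 2 * Re (poly H (\<omega> z / of_real s)) + 2) 1"
  proof (intro circle_mean_mono continuous_on_add continuous_on_mult_left c1)
    show "continuous_on (sphere 0 1) (\<lambda>z. (norm (G (\<omega> z)))\<^sup>2)"
      using w1 by (intro continuous_intros continuous_on_compose2[OF holomorphic_on_imp_continuous_on[OF hG]]
          continuous_on_subset[OF w(1)]) auto
    fix z :: complex assume "z \<in> sphere 0 1"
    then have z: "norm (\<omega> z / of_real s) \<le> 1" by (intro ws) auto
    have "(norm (G (\<omega> z)))\<^sup>2 \<le> 2 * (norm (poly T (\<omega> z / of_real s)))\<^sup>2 + 2 * 1\<^sup>2"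
      using T[OF z] s by (intro norm_diff_square_le) auto
    also have "\<dots> \<le> 2 * Re (poly H (\<omega> z / of_real s)) + 2"
      using harmonic_majorant_ge[OF H z] by simp
    finally show "(norm (G (\<omega> z)))\<^sup>2 \<le> 2 * Re (poly H (\<omega> z / of_real s)) + 2" .
  qed auto
  also have "\<dots> = 2 * Re (circle_mean (\<lambda>z. poly H (\<omega> z / of_real s)) 1) + 2"
    using c1 continuous_on_subset[OF c\<omega>, of "sphere 0 1"]
    by (simp add: circle_mean_add circle_mean_mult continuous_on_mult_left circle_mean_Re subset_eq)
  also have "circle_mean (\<lambda>z. poly H (\<omega> z / of_real s)) 1 = poly H 0"
    using circle_mean_holomorphic[OF c\<omega> h\<omega>] w(3) by simp
  \<comment> \<open>\<open>4 * M + 6\<close> is \<open>2 * (2 * M + 2) + 2\<close>: passing from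
    \<open>G\<close> to \<open>T\<close> and back each costs a factor 2 and an additive 2.\<close>
  finally show ?thesis using H0 by simp
qed

section \<open>Uniform oscillation bounds for dilates of BMOA functions\<close>

lemma BMOA_imp_holomorphic: "g \<in> BMOA \<Longrightarrow> g holomorphic_on unit_disk"
  by (simp add: BMOA_def hardy_space_def)

lemma BMOA_circle_mean_le:
  assumes g: "g \<in> BMOA"
  obtains M where "0 \<le> M" "\<And>a r. norm a < 1 \<Longrightarrow> r \<in> {0..<1} \<Longrightarrow>
    circle_mean (\<lambda>z. (norm (g (disk_involution a z) - g a))\<^sup>2) r \<le> M"
proof -
  note hg = BMOA_imp_holomorphic[OF g]
  obtain C where C: "(SUP a\<in>unit_disk. hardy_norm 2 (\<lambda>z. g (disk_involution a z) - g a)) = ennreal C" "0 \<le> C"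
    using g unfolding BMOA_def
    by (cases "SUP a\<in>unit_disk. hardy_norm 2 (\<lambda>z. g (disk_involution a z) - g a)") auto
  show thesis
  proof (rule that[of "C powr 2"])
    fix a :: complex and r :: real assume a: "norm a < 1" and r: "r \<in> {0..<1}"
    have "hardy_norm 2 (\<lambda>z. g (disk_involution a z) - g a) \<le> ennreal C"
      unfolding C(1)[symmetric] using a by (intro SUP_upper) auto
    moreover have "continuous_on unit_disk (\<lambda>z. g (disk_involution a z) - g a)"
      using disk_involution_norm_less[OF a]
      by (intro continuous_intros continuous_on_compose2[OF holomorphic_on_imp_continuous_on[OF hg]]
          holomorphic_on_imp_continuous_on[OF disk_involution_holomorphic[OF a]]) auto
    ultimately show "circle_mean (\<lambda>z. (norm (g (disk_involution a z) - g a))\<^sup>2) r \<le> C powr 2"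
      using hardy_norm_finite_imp[of 2 "\<lambda>z. g (disk_involution a z) - g a" C r] C(2) r by simp
  qed auto
qed

text \<open>With b = r a, the dilate composed with the involution at \<open>a\<close> is
  \<open>g\<close> composed with the involution at b and a self-map of the disk fixing 0.
  Subordination therefore transfers the bound at b, with constants independent of \<open>a\<close>
  and \<open>r\<close>.\<close>

lemma BMOA_dilate:
  assumes g: "g \<in> BMOA"
  obtains M where "0 \<le> M" "\<And>a r. norm a < 1 \<Longrightarrow> 0 < r \<Longrightarrow> r < 1 \<Longrightarrow>
    circle_mean (\<lambda>z. (norm (g (of_real r * disk_involution a z) - g (of_real r * a)))\<^sup>2) 1 \<le> M"
proof -
  note hg = BMOA_imp_holomorphic[OF g]
  obtain M where M: "0 \<le> M" "\<And>a r. norm a < 1 \<Longrightarrow> r \<in> {0..<1} \<Longrightarrow>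
    circle_mean (\<lambda>z. (norm (g (disk_involution a z) - g a))\<^sup>2) r \<le> M"
    using BMOA_circle_mean_le[OF g] by blast
  show thesis
  proof (rule that[of "4 * M + 6"])
    fix a :: complex and r :: real assume a: "norm a < 1" and r: "0 < r" "r < 1"
    define b where "b = of_real r * a"
    have b: "norm b < 1" unfolding b_def norm_mult using a r mult_strict_mono[of r 1 "norm a" 1] by simp
    define G where "G z = g (disk_involution b z) - g b" for z
    define \<omega> where "\<omega> z = disk_involution b (of_real r * disk_involution a z)" for z
    have ra: "norm (of_real r * disk_involution a z) < 1" if "norm z \<le> 1" for z
    proof -
      have "norm (of_real r * disk_involution a z) \<le> r * 1"
        unfolding norm_mult using disk_involution_norm_le[OF a that] r by (intro mult_mono) auto
      then show ?thesis using r by simp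
    qed
    have "circle_mean (\<lambda>z. (norm (G (\<omega> z)))\<^sup>2) 1 \<le> 4 * M + 6"
    proof (rule subordination[of G M \<omega>])
      show "G holomorphic_on unit_disk" unfolding G_def
        using disk_involution_norm_less[OF b]
        by (intro holomorphic_intros holomorphic_on_compose_gen[OF disk_involution_holomorphic[OF b] hg, unfolded o_def]) auto
      show "circle_mean (\<lambda>z. (norm (G z))\<^sup>2) r \<le> M" if "r \<in> {0..<1}" for r
        unfolding G_def by (rule M(2)[OF b that])
      show "continuous_on (cball 0 1) \<omega>" unfolding \<omega>_def using ra less_imp_le[OF ra]
        by (intro continuous_on_compose2[OF disk_involution_continuous[OF b]] continuous_intros
            disk_involution_continuous a) auto
      show "\<omega> holomorphic_on ball 0 1" unfolding \<omega>_def using ra less_imp_le[OF ra]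
        by (intro holomorphic_on_compose_gen[OF _ disk_involution_holomorphic[OF b],
              of "\<lambda>z. of_real r * disk_involution a z", unfolded o_def] holomorphic_intros
            disk_involution_holomorphic a) auto
      show "\<omega> 0 = 0" by (simp add: \<omega>_def disk_involution_def b_def)
      show "norm (\<omega> z) < 1" if "norm z \<le> 1" for z
        unfolding \<omega>_def by (intro disk_involution_norm_less b ra that)
    qed
    moreover have "circle_mean (\<lambda>z. (norm (G (\<omega> z)))\<^sup>2) 1
      = circle_mean (\<lambda>z. (norm (g (of_real r * disk_involution a z) - g (of_real r * a)))\<^sup>2) 1"
      using disk_involution_involution[OF b ra] by (intro circle_mean_cong) (auto simp: G_def \<omega>_def b_def)
    ultimately show "circle_mean (\<lambda>z. (norm (g (of_real r * disk_involution a z) - g (of_real r * a)))\<^sup>2) 1 \<le> 4 * M + 6"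
      by simp
  qed (use M(1) in simp)
qed

section \<open>Higher integrability of BMOA functions\<close>

lemma circle_mean_monomials:
  assumes "0 < s"
  shows "circle_mean (\<lambda>z. z ^ j * cnj z ^ k) s = (if j = k then of_real s ^ (2 * k) else 0)"
proof -
  have le: "circle_mean (\<lambda>z. z ^ j * cnj z ^ k) s = (if j = k then of_real s ^ (2 * k) else 0)" if "k \<le> j" for j k
  proof -
    have "circle_mean (\<lambda>z. z ^ j * cnj z ^ k) s = circle_mean (\<lambda>z. of_real s ^ (2 * k) * z ^ (j - k)) s"
    proof (rule circle_mean_cong)
      fix z :: complex assume "z \<in> sphere 0 s"
      then have "z * cnj z = of_real s ^ 2" by (simp add: complex_norm_square[symmetric])
      then have "z ^ k * cnj z ^ k = of_real s ^ (2 * k)" by (simp add: power_mult flip: power_mult_distrib)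
      moreover have "z ^ j = z ^ (j - k) * z ^ k" using that by (simp flip: power_add)
      ultimately show "z ^ j * cnj z ^ k = of_real s ^ (2 * k) * z ^ (j - k)" by (simp add: mult_ac)
    qed (use assms in simp)
    also have "\<dots> = of_real s ^ (2 * k) * 0 ^ (j - k)"
    proof -
      have "circle_mean (\<lambda>z::complex. z ^ (j - k)) s = 0 ^ (j - k)"
        using assms by (intro circle_mean_holomorphic continuous_intros holomorphic_intros) auto
      then show ?thesis using assms by (subst circle_mean_mult) (auto intro!: continuous_intros)
    qed
    finally show ?thesis using that by (auto simp: power_0_left)
  qed
  show ?thesis
  proof (cases "k \<le> j")
    case False
    have "circle_mean (\<lambda>z. z ^ j * cnj z ^ k) s = circle_mean (\<lambda>z. cnj (z ^ k * cnj z ^ j)) s"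
      by (simp add: mult.commute)
    also have "\<dots> = cnj (circle_mean (\<lambda>z. z ^ k * cnj z ^ j) s)"
      using assms by (intro circle_mean_bounded_linear bounded_linear_cnj continuous_intros) auto
    finally show ?thesis using le[of j k] False by simp
  qed (rule le)
qed

lemma poly_eq_sum:
  fixes p :: "complex poly"
  assumes "degree p \<le> N"
  shows "poly p z = (\<Sum>i\<le>N. coeff p i * z ^ i)"
  unfolding poly_altdef
  by (intro sum.mono_neutral_left) (use assms in \<open>auto simp: coeff_eq_0\<close>)

lemma circle_mean_poly_inner:
  assumes "degree p \<le> N" "degree q \<le> N" "0 < s"
  shows "circle_mean (\<lambda>z. poly p z * cnj (poly q z)) s
    = (\<Sum>k\<le>N. coeff p k * cnj (coeff q k) * of_real s ^ (2 * k))"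
proof -
  have "circle_mean (\<lambda>z. poly p z * cnj (poly q z)) s
    = circle_mean (\<lambda>z. \<Sum>j\<le>N. \<Sum>k\<le>N. (coeff p j * cnj (coeff q k)) * (z ^ j * cnj z ^ k)) s"
    by (simp add: poly_eq_sum[OF assms(1)] poly_eq_sum[OF assms(2)] cnj_sum sum_product mult_ac)
  also have "\<dots> = (\<Sum>j\<le>N. \<Sum>k\<le>N. (coeff p j * cnj (coeff q k)) * (if j = k then of_real s ^ (2 * k) else 0))"
  proof -
    have "circle_mean (\<lambda>z. c * (z ^ j * cnj z ^ k)) s = c * (if j = k then of_real s ^ (2 * k) else 0)"
      for c j k
      using assms(3) unfolding circle_mean_monomials[OF assms(3), symmetric]
      by (intro circle_mean_mult continuous_intros) auto
    moreover have "circle_mean (\<lambda>z. \<Sum>k\<le>N. c k * (z ^ j * cnj z ^ k)) s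
      = (\<Sum>k\<le>N. circle_mean (\<lambda>z. c k * (z ^ j * cnj z ^ k)) s)" for c j
      using assms(3) by (intro circle_mean_sum continuous_intros) auto
    ultimately show ?thesis
      using assms(3) by (subst circle_mean_sum) (auto intro!: continuous_intros)
  qed
  also have "\<dots> = (\<Sum>k\<le>N. coeff p k * cnj (coeff q k) * of_real s ^ (2 * k))"
    by (simp add: if_distrib cong: if_cong)
  finally show ?thesis .
qed

text \<open>Two integrations of \<open>x (x m')' = \<Sum> (k + 1)\<^sup>2 d (k + 1) x ^ (k + 1)\<close>
  for the radial mean \<open>m x = \<Sum> d k x ^ k\<close>, with \<open>x\<close> the squared radius.\<close>
lemma radial_mean_increase:
  fixes d :: "nat \<Rightarrow> real"
  assumes nonneg: "\<And>x. 0 < x \<Longrightarrow> x < 1 \<Longrightarrow> 0 \<le> (\<Sum>k<N. (real (Suc k))\<^sup>2 * d (Suc k) * x ^ k)"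
  shows "0 \<le> (\<Sum>k<N. d (Suc k))"
proof -
  \<comment> \<open>\<open>P x\<close> is x m'(x). It vanishes at 0 and has nonnegative derivative,
    so m' is nonnegative on the open unit interval as well.\<close>
  define P where "P x = (\<Sum>k<N. real (Suc k) * d (Suc k) * x ^ Suc k)" for x :: real
  define m where "m x = (\<Sum>k<N. d (Suc k) * x ^ Suc k)" for x :: real
  have dP: "(P has_real_derivative (\<Sum>k<N. (real (Suc k))\<^sup>2 * d (Suc k) * x ^ k)) (at x)" for x
    unfolding P_def by (auto intro!: derivative_eq_intros sum.cong simp: power2_eq_square simp del: of_nat_Suc power_Suc)
  have dm: "(m has_real_derivative (\<Sum>k<N. real (Suc k) * d (Suc k) * x ^ k)) (at x)" for x
    unfolding m_def by (auto intro!: derivative_eq_intros sum.cong simp del: of_nat_Suc power_Suc)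
  have P0: "0 \<le> P x" if x: "0 < x" "x < 1" for x
  proof -
    have "P 0 \<le> P x"
    proof (rule DERIV_nonneg_imp_increasing_open[of 0 x P])
      show "\<exists>y'. (P has_real_derivative y') (at y) \<and> 0 \<le> y'" if "0 < y" "y < x" for y
        using dP[of y] nonneg[of y] that x by auto
      show "continuous_on {0..x} P" unfolding P_def by (intro continuous_intros)
    qed (use x in simp)
    then show ?thesis by (simp add: P_def)
  qed
  have "m 0 \<le> m 1"
  proof (rule DERIV_nonneg_imp_increasing_open[of 0 1 m])
    show "\<exists>y'. (m has_real_derivative y') (at y) \<and> 0 \<le> y'" if y: "0 < y" "y < 1" for y
    proof -
      have "P y = y * (\<Sum>k<N. real (Suc k) * d (Suc k) * y ^ k)"
        by (simp add: P_def sum_distrib_left mult_ac)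
      then have "0 \<le> (\<Sum>k<N. real (Suc k) * d (Suc k) * y ^ k)"
        using P0[OF y] y by (simp add: zero_le_mult_iff)
      then show ?thesis using dm[of y] by blast
    qed
    show "continuous_on {0..1} m" unfolding m_def by (intro continuous_intros)
  qed simp
  then show ?thesis by (simp add: m_def)
qed

text \<open>The sum over the derivatives is a quarter of the Laplacian of the function being
  averaged, so this is the sub-mean-value property of a subharmonic function. Sums of products,
  rather than of squares, allow real functions that are differences or products. By orthogonality
  the radial means are polynomials in the squared radius, which reduces everything to one real
  variable.\<close>

lemma sub_mean_value_poly:
  fixes a b :: "'i \<Rightarrow> complex poly"
  assumes fin: "finite J"
    and lap: "\<And>z. norm z < 1 \<Longrightarrow> 0 \<le> Re (\<Sum>j\<in>J. poly (pderiv (a j)) z * cnj (poly (pderiv (b j)) z))"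
  shows "Re (\<Sum>j\<in>J. poly (a j) 0 * cnj (poly (b j) 0))
    \<le> circle_mean (\<lambda>z. Re (\<Sum>j\<in>J. poly (a j) z * cnj (poly (b j) z))) 1"
proof -
  define N where "N = (\<Sum>j\<in>J. degree (a j) + degree (b j))"
  have deg: "degree (a j) \<le> N" "degree (b j) \<le> N" if "j \<in> J" for j
    using member_le_sum[of j J "\<lambda>j. degree (a j) + degree (b j)"] that fin by (auto simp: N_def)
  have deg': "degree (pderiv (a j)) \<le> N" "degree (pderiv (b j)) \<le> N" if "j \<in> J" for j
    using deg[OF that] by (simp_all add: degree_pderiv)
  define d where "d k = Re (\<Sum>j\<in>J. coeff (a j) k * cnj (coeff (b j) k))" for k
  have mean: "circle_mean (\<lambda>z. Re (\<Sum>j\<in>J. poly (p j) z * cnj (poly (q j) z))) s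
      = (\<Sum>k\<le>N. Re (\<Sum>j\<in>J. coeff (p j) k * cnj (coeff (q j) k)) * s ^ (2 * k))"
    if "\<And>j. j \<in> J \<Longrightarrow> degree (p j) \<le> N" "\<And>j. j \<in> J \<Longrightarrow> degree (q j) \<le> N" "0 < s"
    for p q :: "'i \<Rightarrow> complex poly" and s
  proof -
    have "circle_mean (\<lambda>z. Re (\<Sum>j\<in>J. poly (p j) z * cnj (poly (q j) z))) s
      = Re (\<Sum>j\<in>J. circle_mean (\<lambda>z. poly (p j) z * cnj (poly (q j) z)) s)"
    proof -
      have "circle_mean (\<lambda>z. \<Sum>j\<in>J. poly (p j) z * cnj (poly (q j) z)) s
          = (\<Sum>j\<in>J. circle_mean (\<lambda>z. poly (p j) z * cnj (poly (q j) z)) s)"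
        using that(3) by (intro circle_mean_sum continuous_intros) auto
      then show ?thesis
        using that(3) by (subst circle_mean_Re) (auto intro!: continuous_intros)
    qed
    also have "\<dots> = Re (\<Sum>j\<in>J. \<Sum>k\<le>N. coeff (p j) k * cnj (coeff (q j) k) * of_real s ^ (2 * k))"
      using that by (intro arg_cong[of _ _ Re] sum.cong refl circle_mean_poly_inner) auto
    also have "\<dots> = Re (\<Sum>k\<le>N. (\<Sum>j\<in>J. coeff (p j) k * cnj (coeff (q j) k)) * of_real (s ^ (2 * k)))"
      by (subst sum.swap) (simp add: sum_distrib_right)
    also have "\<dots> = (\<Sum>k\<le>N. Re (\<Sum>j\<in>J. coeff (p j) k * cnj (coeff (q j) k)) * s ^ (2 * k))"
    proof -
      have "Re (x * of_real y) = Re x * y" for x y by simp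
      then show ?thesis by (simp only: Re_sum)
    qed
    finally show ?thesis .
  qed
  have "0 \<le> (\<Sum>k<N. d (Suc k))"
  proof (rule radial_mean_increase)
    fix x :: real assume x: "0 < x" "x < 1"
    define s where "s = sqrt x"
    have s: "0 < s" "s < 1" "s\<^sup>2 = x" using x by (auto simp: s_def)
    have "0 \<le> circle_mean (\<lambda>z. Re (\<Sum>j\<in>J. poly (pderiv (a j)) z * cnj (poly (pderiv (b j)) z))) s"
      using s by (intro circle_mean_nonneg continuous_intros lap) auto
    also have "\<dots> = (\<Sum>k\<le>N. Re (\<Sum>j\<in>J. coeff (pderiv (a j)) k * cnj (coeff (pderiv (b j)) k)) * s ^ (2 * k))"
      using deg' s by (intro mean) auto
    also have "\<dots> = (\<Sum>k\<le>N. (real (Suc k))\<^sup>2 * d (Suc k) * x ^ k)"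
    proof (intro sum.cong refl arg_cong2[of _ _ _ _ "(*)"])
      fix k
      have "(\<Sum>j\<in>J. coeff (pderiv (a j)) k * cnj (coeff (pderiv (b j)) k))
        = of_real ((real (Suc k))\<^sup>2) * (\<Sum>j\<in>J. coeff (a j) (Suc k) * cnj (coeff (b j) (Suc k)))"
        by (simp add: coeff_pderiv sum_distrib_left power2_eq_square mult_ac)
      then show "Re (\<Sum>j\<in>J. coeff (pderiv (a j)) k * cnj (coeff (pderiv (b j)) k)) = (real (Suc k))\<^sup>2 * d (Suc k)"
        by (simp only: d_def Re_complex_of_real Im_complex_of_real times_complex.sel mult_zero_left diff_zero)
      show "s ^ (2 * k) = x ^ k" using s by (simp add: power_mult)
    qed
    also have "\<dots> = (\<Sum>k<N. (real (Suc k))\<^sup>2 * d (Suc k) * x ^ k)"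
    proof (rule sum.mono_neutral_right)
      \<comment> \<open>The sum over derivative coefficients formally reaches index
        \<open>Suc N\<close> of the original polynomials; that term vanishes because
        \<open>N\<close> bounds all degrees.\<close>
      have "coeff (a j) (Suc N) = 0" if "j \<in> J" for j
        using deg(1)[OF that] by (simp add: coeff_eq_0)
      then have "d (Suc N) = 0" by (simp add: d_def)
      then show "\<forall>k\<in>{..N} - {..<N}. (real (Suc k))\<^sup>2 * d (Suc k) * x ^ k = 0"
        by (auto simp: not_less le_antisym)
    qed auto
    finally show "0 \<le> (\<Sum>k<N. (real (Suc k))\<^sup>2 * d (Suc k) * x ^ k)" .
  qed
  \<comment> \<open>\<open>d 0\<close> is the value at the centre, and the full sum is the mean over
    the unit circle.\<close>
  then have "d 0 \<le> (\<Sum>k\<le>N. d k)" by (simp add: sum.atMost_shift)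
  also have "\<dots> = circle_mean (\<lambda>z. Re (\<Sum>j\<in>J. poly (a j) z * cnj (poly (b j) z))) 1"
    using mean[of a b 1] deg by (simp add: d_def)
  finally show ?thesis by (simp add: d_def poly_0_coeff_0)
qed

text \<open>With \<open>W = K - Re H + |T|\<^sup>2\<close> and \<open>f = T ^ n\<close>, the function
  \<open>W\<^sup>2 |f|\<^sup>2 + K\<^sup>2 |f|\<^sup>2 - c |T ^ Suc n|\<^sup>2\<close> is subharmonic: the only terms of its
  Laplacian without a sign form the square of \<open>W\<^sub>z f + W f'\<close>.\<close>
lemma power_mean_step:
  fixes T H :: "complex poly" and K :: real
  assumes sphere: "\<And>z. norm z = 1 \<Longrightarrow> Re (poly H z) = (norm (poly T z))\<^sup>2"
    and lo: "\<And>z. norm z < 1 \<Longrightarrow> (norm (poly T z))\<^sup>2 \<le> Re (poly H z)"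
    and hi: "\<And>z. norm z < 1 \<Longrightarrow> Re (poly H z) \<le> (norm (poly T z))\<^sup>2 + K - 1"
  shows "circle_mean (\<lambda>z. (norm (poly T z))\<^sup>2 ^ Suc n) 1
    \<le> (real (Suc n))\<^sup>2 * K\<^sup>2 * circle_mean (\<lambda>z. (norm (poly T z))\<^sup>2 ^ n) 1
      + (norm (poly T 0))\<^sup>2 ^ Suc n"
proof -
  define f where "f = T ^ n"
  \<comment> \<open>The factor makes \<open>q\<close> plus its conjugate equal to -Re H.\<close>
  define q where "q = smult (- 1 / 2) H"
  \<comment> \<open>The derivative of \<open>T ^ Suc n\<close> is \<open>Suc n\<close> times f T'.
    With this \<open>c\<close>, the subtracted term contributes exactly 2 |T'|^2 |f|^2, which the
    term 2 W |T'|^2 |f|^2 can pay for once W is at least 1.\<close>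
  define c where "c = 2 / (real (Suc n))\<^sup>2"
  define \<alpha> where "\<alpha> = (!) [[:of_real K:], q, 1, T]"
  define \<beta> where "\<beta> = (!) [1, 1, q, T]"
  \<comment> \<open>The function in question is the sum of \<open>a x * cnj (b x)\<close>: the pairs of \<open>\<alpha>\<close> and \<open>\<beta>\<close> expand
    \<open>W = K - Re H + |T|\<^sup>2\<close>.\<close>
  define a where "a = case_sum (\<lambda>(i, j). \<alpha> i * \<alpha> j * f) ((!) [smult (of_real K) f, smult (- of_real c) (T ^ Suc n)])"
  define b where "b = case_sum (\<lambda>(i, j). \<beta> i * \<beta> j * f) ((!) [smult (of_real K) f, T ^ Suc n])"
  define J :: "(nat \<times> nat + nat) set" where "J = ({..<4} \<times> {..<4}) <+> {..<2}"
  have sumJ: "(\<Sum>x\<in>J. h x) = (\<Sum>i<4. \<Sum>j<4. h (Inl (i, j))) + (\<Sum>i<2. h (Inr i))" for h :: "_ \<Rightarrow> complex"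
    by (simp add: J_def sum.Plus sum.cartesian_product)
  define W where "W z = K - Re (poly H z) + (norm (poly T z))\<^sup>2" for z
  have WC: "of_real (W z) = of_real K + poly q z + cnj (poly q z) + poly T z * cnj (poly T z)" for z
    unfolding W_def q_def cmod_power2 by (simp add: complex_eq_iff power2_eq_square algebra_simps)
  have val: "(\<Sum>x\<in>J. poly (a x) z * cnj (poly (b x) z))
      = of_real ((W z)\<^sup>2 * (norm (poly f z))\<^sup>2 + K\<^sup>2 * (norm (poly f z))\<^sup>2 - c * (norm (poly T z))\<^sup>2 ^ Suc n)" for z
  proof -
    have f2: "of_real ((norm (poly f z))\<^sup>2) = poly f z * cnj (poly f z)"
      by (simp only: complex_norm_square)
    have T2: "of_real ((norm (poly T z))\<^sup>2 ^ Suc n) = poly (T ^ Suc n) z * cnj (poly (T ^ Suc n) z)"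
      by (simp only: of_real_power[of "(norm (poly T z))\<^sup>2"] complex_norm_square poly_power power_mult_distrib complex_cnj_power)
    have "(\<Sum>i<4. \<Sum>j<4. poly (a (Inl (i, j))) z * cnj (poly (b (Inl (i, j))) z))
      = (of_real (W z))\<^sup>2 * (poly f z * cnj (poly f z))"
      unfolding WC by (simp add: a_def b_def \<alpha>_def \<beta>_def eval_nat_numeral algebra_simps)
    moreover have "(\<Sum>i<2. poly (a (Inr i)) z * cnj (poly (b (Inr i)) z))
      = of_real (K\<^sup>2) * (poly f z * cnj (poly f z)) - of_real c * (poly (T ^ Suc n) z * cnj (poly (T ^ Suc n) z))"
      by (simp add: a_def b_def eval_nat_numeral algebra_simps del: power_Suc) simp
    ultimately show ?thesis
      unfolding sumJ f2[symmetric] T2[symmetric] by simp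
  qed
  have lap: "0 \<le> Re (\<Sum>x\<in>J. poly (pderiv (a x)) z * cnj (poly (pderiv (b x)) z))" if z: "norm z < 1" for z
  proof -
    define t where "t = poly (pderiv T) z"
    define f' where "f' = poly (pderiv f) z"
    \<comment> \<open>This is the z-derivative of \<open>W\<close>; the mixed derivative of
      \<open>W\<close> in z and its conjugate is \<open>t * cnj t\<close>.\<close>
    define u where "u = poly (pderiv q) z + t * cnj (poly T z)"
    have W1: "1 \<le> W z" "W z \<le> K" using lo[OF z] hi[OF z] by (auto simp: W_def)
    have "(\<Sum>i<4. \<Sum>j<4. poly (pderiv (a (Inl (i, j)))) z * cnj (poly (pderiv (b (Inl (i, j)))) z))
      = 2 * of_real (W z) * (t * cnj t) * (poly f z * cnj (poly f z))
        + 2 * ((u * poly f z + of_real (W z) * f') * (cnj u * cnj (poly f z) + of_real (W z) * cnj f'))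
        - (of_real (W z))\<^sup>2 * (f' * cnj f')"
      unfolding WC
      by (simp add: a_def b_def \<alpha>_def \<beta>_def t_def u_def f'_def eval_nat_numeral pderiv_mult pderiv_pCons algebra_simps)
    also have "\<dots> = of_real (2 * W z * ((norm t)\<^sup>2 * (norm (poly f z))\<^sup>2)
        + 2 * (norm (u * poly f z + of_real (W z) * f'))\<^sup>2 - (W z)\<^sup>2 * (norm f')\<^sup>2)"
      by (simp add: complex_norm_square del: of_real_power) simp
    finally have 1: "Re (\<Sum>i<4. \<Sum>j<4. poly (pderiv (a (Inl (i, j)))) z * cnj (poly (pderiv (b (Inl (i, j)))) z))
      = 2 * W z * ((norm t)\<^sup>2 * (norm (poly f z))\<^sup>2)
        + 2 * (norm (u * poly f z + of_real (W z) * f'))\<^sup>2 - (W z)\<^sup>2 * (norm f')\<^sup>2"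
      by (simp only: Re_complex_of_real)
    define m where "m = real (Suc n)"
    have cm: "c * (m * m) = 2" by (simp add: c_def m_def power2_eq_square del: of_nat_Suc)
    have "poly (pderiv (T ^ Suc n)) z = of_real m * poly f z * t"
      by (simp add: pderiv_power_Suc t_def f_def m_def del: of_nat_Suc power_Suc)
    then have "(\<Sum>i<2. poly (pderiv (a (Inr i))) z * cnj (poly (pderiv (b (Inr i))) z))
      = of_real (K * K) * (f' * cnj f') - of_real (c * (m * m)) * ((t * cnj t) * (poly f z * cnj (poly f z)))"
      by (simp add: a_def b_def numeral_2_eq_2 pderiv_smult pderiv_minus f'_def mult_ac del: power_Suc)
    also have "\<dots> = of_real (K * K * (norm f')\<^sup>2 - c * (m * m) * ((norm t)\<^sup>2 * (norm (poly f z))\<^sup>2))"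
      by (simp add: complex_norm_square del: of_real_power)
    finally have 2: "Re (\<Sum>i<2. poly (pderiv (a (Inr i))) z * cnj (poly (pderiv (b (Inr i))) z))
      = K\<^sup>2 * (norm f')\<^sup>2 - 2 * ((norm t)\<^sup>2 * (norm (poly f z))\<^sup>2)"
      by (simp only: cm Re_complex_of_real power2_eq_square)
    have "2 * ((norm t)\<^sup>2 * (norm (poly f z))\<^sup>2) \<le> 2 * W z * ((norm t)\<^sup>2 * (norm (poly f z))\<^sup>2)"
      using W1 by (intro mult_right_mono) auto
    \<comment> \<open>The summand K^2 |f|^2 was added to the function for this: completing the
      square leaves -W^2 |f'|^2, which it compensates.\<close>
    moreover have "(W z)\<^sup>2 * (norm f')\<^sup>2 \<le> K\<^sup>2 * (norm f')\<^sup>2"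
      using W1 by (intro mult_right_mono power_mono) auto
    moreover have "0 \<le> (norm (u * poly f z + of_real (W z) * f'))\<^sup>2" by simp
    ultimately show ?thesis unfolding sumJ plus_complex.sel 1 2 by linarith
  qed
  have "finite J" by (simp add: J_def)
  from sub_mean_value_poly[OF this lap]
  have "Re (\<Sum>x\<in>J. poly (a x) 0 * cnj (poly (b x) 0))
    \<le> circle_mean (\<lambda>z. Re (\<Sum>x\<in>J. poly (a x) z * cnj (poly (b x) z))) 1" .
  also have "\<dots> = circle_mean (\<lambda>z. 2 * K\<^sup>2 * (norm (poly T z))\<^sup>2 ^ n + (- c) * (norm (poly T z))\<^sup>2 ^ Suc n) 1"
  proof (rule circle_mean_cong)
    fix z :: complex assume "z \<in> sphere 0 1"
    \<comment> \<open>The defect vanishes on the circle, so both weighted terms there reduce to the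
      plain mean of |f|^2.\<close>
    then have "W z = K" using sphere by (simp add: W_def)
    moreover have "(norm (poly f z))\<^sup>2 = (norm (poly T z))\<^sup>2 ^ n"
      by (simp add: f_def norm_power power_commutes flip: power_mult power_mult_distrib) (simp add: mult.commute)
    ultimately show "Re (\<Sum>x\<in>J. poly (a x) z * cnj (poly (b x) z))
      = 2 * K\<^sup>2 * (norm (poly T z))\<^sup>2 ^ n + (- c) * (norm (poly T z))\<^sup>2 ^ Suc n"
      unfolding val Re_complex_of_real by simp
  qed simp
  also have "\<dots> = 2 * K\<^sup>2 * circle_mean (\<lambda>z. (norm (poly T z))\<^sup>2 ^ n) 1
      + (- c) * circle_mean (\<lambda>z. (norm (poly T z))\<^sup>2 ^ Suc n) 1"
  proof -
    have c: "continuous_on (sphere 0 1) (\<lambda>z. (norm (poly T z))\<^sup>2 ^ k)" for k by (intro continuous_intros)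
    show ?thesis
      by (subst circle_mean_add) (simp_all only: circle_mean_mult[OF c] continuous_on_mult_left[OF c] zero_le_one)
  qed
  also have "Re (\<Sum>x\<in>J. poly (a x) 0 * cnj (poly (b x) 0))
    = (W 0)\<^sup>2 * (norm (poly f 0))\<^sup>2 + K\<^sup>2 * (norm (poly f 0))\<^sup>2 - c * (norm (poly T 0))\<^sup>2 ^ Suc n"
    unfolding val by (rule Re_complex_of_real)
  finally have "(W 0)\<^sup>2 * (norm (poly f 0))\<^sup>2 + K\<^sup>2 * (norm (poly f 0))\<^sup>2 - c * (norm (poly T 0))\<^sup>2 ^ Suc n
    \<le> 2 * K\<^sup>2 * circle_mean (\<lambda>z. (norm (poly T z))\<^sup>2 ^ n) 1
      + (- c) * circle_mean (\<lambda>z. (norm (poly T z))\<^sup>2 ^ Suc n) 1" .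
  moreover have "0 \<le> (W 0)\<^sup>2 * (norm (poly f 0))\<^sup>2 + K\<^sup>2 * (norm (poly f 0))\<^sup>2" by simp
  ultimately have "c * circle_mean (\<lambda>z. (norm (poly T z))\<^sup>2 ^ Suc n) 1
    \<le> 2 * K\<^sup>2 * circle_mean (\<lambda>z. (norm (poly T z))\<^sup>2 ^ n) 1 + c * (norm (poly T 0))\<^sup>2 ^ Suc n"
    by linarith
  moreover have "X \<le> m\<^sup>2 * K\<^sup>2 * Y + Z" if "2 / m\<^sup>2 * X \<le> 2 * K\<^sup>2 * Y + 2 / m\<^sup>2 * Z" "0 < m" for X Y Z m :: real
    using that by (simp add: field_simps)
  ultimately show ?thesis unfolding c_def by simp
qed

text \<open>Induction on even powers for a polynomial near the dilate, with
  \<open>power_mean_step\<close> as the induction step. The oscillation bound for dilates supplies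
  its hypothesis on the defect with a \<open>K\<close> independent of the radius and of the
  polynomial, so the bound passes to all means of \<open>g\<close>.\<close>

lemma BMOA_bounded_means:
  assumes g: "g \<in> BMOA" and q: "0 < q"
  shows "bounded_means q g"
proof -
  note hg = BMOA_imp_holomorphic[OF g]
  note cg = holomorphic_on_imp_continuous_on[OF hg]
  obtain M where M: "0 \<le> M" "\<And>a r. norm a < 1 \<Longrightarrow> 0 < r \<Longrightarrow> r < 1 \<Longrightarrow>
    circle_mean (\<lambda>z. (norm (g (of_real r * disk_involution a z) - g (of_real r * a)))\<^sup>2) 1 \<le> M"
    using BMOA_dilate[OF g] by blast
  \<comment> \<open>Replacing the dilate by \<open>T\<close> changes each difference by at most 2,
    so the oscillation is at most \<open>2 * M + 8\<close>; the extra 1 keeps the weight at least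
    1.\<close>
  define K where "K = 2 * M + 9"
  \<comment> \<open>The recursion of \<open>power_mean_step\<close>, with the value at the centre
    replaced by its bound; it involves neither the radius nor \<open>T\<close>.\<close>
  define C where "C = rec_nat 1 (\<lambda>n c. (real (Suc n))\<^sup>2 * K\<^sup>2 * c + (norm (g 0) + 1)\<^sup>2 ^ Suc n)"
  obtain k :: nat where k: "q \<le> real k" using real_arch_simple by blast
  define m where "m = Suc k"
  have bound: "circle_mean (\<lambda>z. norm (g z) powr (2 * m)) r \<le> 2 powr (2 * m) * (C m + 1)"
    if r: "0 < r" "r < 1" for r
  proof -
    define G where "G z = g (of_real r * z)" for z
    have "G holomorphic_on ball 0 (1 / r)" unfolding G_def
      using r by (intro holomorphic_on_compose_gen[OF _ hg, of "(*) (of_real r)", unfolded o_def] holomorphic_intros)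
        (auto simp: norm_mult field_simps)
    then obtain T where T: "\<And>z. norm z \<le> 1 \<Longrightarrow> norm (G z - poly T z) < 1"
      using polynomial_approximation[of G "1 / r" 1] r by auto
    obtain H where H: "\<And>z. norm z = 1 \<Longrightarrow> Re (poly H z) = (norm (poly T z))\<^sup>2"
      using harmonic_majorant_poly by blast
    have cG: "continuous_on (cball 0 1) G" unfolding G_def
    proof (intro continuous_on_compose2[OF cg] continuous_intros)
      show "(*) (of_real r) ` cball 0 1 \<subseteq> unit_disk"
        using r by (auto simp: norm_mult) (smt (verit) mult_left_le)
    qed
    have hi: "Re (poly H a) \<le> (norm (poly T a))\<^sup>2 + K - 1" if a: "norm a < 1" for a
    proof -
      have cs: "continuous_on (sphere 0 1) (disk_involution a)"
        using disk_involution_continuous[OF a] by (rule continuous_on_subset) auto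
      have c1: "continuous_on (sphere 0 1) (\<lambda>z. (norm (G (disk_involution a z) - G a))\<^sup>2)"
        using disk_involution_norm_le[OF a]
        by (intro continuous_intros continuous_on_compose2[OF cG cs]) auto
      have "circle_mean (\<lambda>z. (norm (poly T (disk_involution a z) - poly T a))\<^sup>2) 1
        \<le> circle_mean (\<lambda>z. 2 * (norm (G (disk_involution a z) - G a))\<^sup>2 + 2 * 2\<^sup>2) 1"
      proof (intro circle_mean_mono continuous_on_add continuous_on_mult_left c1 continuous_on_const)
        show "continuous_on (sphere 0 1) (\<lambda>z. (norm (poly T (disk_involution a z) - poly T a))\<^sup>2)"
          by (intro continuous_intros cs)
        fix z :: complex assume "z \<in> sphere 0 1"
        then have "norm (disk_involution a z) \<le> 1" using disk_involution_norm_eq[OF a] by simp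
        from T[OF this] T[of a] a
        have "norm ((poly T (disk_involution a z) - G (disk_involution a z)) - (poly T a - G a)) \<le> 2"
          using norm_triangle_ineq4[of "poly T (disk_involution a z) - G (disk_involution a z)" "poly T a - G a"]
          by (simp add: norm_minus_commute)
        then show "(norm (poly T (disk_involution a z) - poly T a))\<^sup>2
          \<le> 2 * (norm (G (disk_involution a z) - G a))\<^sup>2 + 2 * 2\<^sup>2"
          by (intro norm_diff_square_le) (simp add: algebra_simps)
      qed simp
      also have "\<dots> = 2 * circle_mean (\<lambda>z. (norm (G (disk_involution a z) - G a))\<^sup>2) 1 + 8"
        using c1 by (simp add: circle_mean_add circle_mean_mult continuous_on_mult_left)
      also have "\<dots> \<le> 2 * M + 8" using M(2)[OF a r] by (simp add: G_def)
      finally show ?thesis using harmonic_majorant_defect[OF H a] by (simp add: K_def)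
    qed
    have T0: "norm (poly T 0) \<le> norm (g 0) + 1"
      using T[of 0] norm_triangle_sub[of "poly T 0" "G 0"] by (simp add: G_def norm_minus_commute)
    have C: "circle_mean (\<lambda>z. (norm (poly T z))\<^sup>2 ^ n) 1 \<le> C n" for n
    proof (induction n)
      case (Suc n)
      have "circle_mean (\<lambda>z. (norm (poly T z))\<^sup>2 ^ Suc n) 1
        \<le> (real (Suc n))\<^sup>2 * K\<^sup>2 * circle_mean (\<lambda>z. (norm (poly T z))\<^sup>2 ^ n) 1 + (norm (poly T 0))\<^sup>2 ^ Suc n"
        by (intro power_mean_step[OF H harmonic_majorant_ge[OF H] hi]) auto
      also have "\<dots> \<le> (real (Suc n))\<^sup>2 * K\<^sup>2 * C n + (norm (g 0) + 1)\<^sup>2 ^ Suc n"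
        using Suc T0 by (intro add_mono mult_left_mono power_mono) auto
      finally show ?case by (simp add: C_def)
    qed (simp add: C_def)
    have "circle_mean (\<lambda>z. norm (g z) powr (2 * m)) r = circle_mean (\<lambda>z. norm (G z) powr (2 * m)) 1"
      unfolding G_def by (rule circle_mean_dilate[symmetric])
    also have "\<dots> \<le> circle_mean (\<lambda>z. 2 powr (2 * m) * ((norm (poly T z))\<^sup>2 ^ m + 1)) 1"
    proof (rule circle_mean_mono)
      show "continuous_on (sphere 0 1) (\<lambda>z. norm (G z) powr (2 * m))"
        by (intro continuous_on_powr' continuous_on_norm continuous_on_const continuous_on_subset[OF cG])
          (auto simp: m_def)
      fix z :: complex assume z: "z \<in> sphere 0 1"
      have "norm (G z) powr (2 * m) \<le> 2 powr (2 * m) * (norm (poly T z) powr (2 * m) + norm (G z - poly T z) powr (2 * m))"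
        using powr_sum_le[of "2 * m" "poly T z" "G z - poly T z"] by (simp add: m_def)
      also have "norm (poly T z) powr (2 * m) = (norm (poly T z))\<^sup>2 ^ m"
      proof -
        have "(1::nat) \<le> 2 * m" by (simp add: m_def)
        from powr_of_power[OF norm_ge_zero this, of "poly T z" 1]
        have "norm (poly T z) powr (2 * m) = norm (poly T z) ^ (2 * m)" by simp
        then show ?thesis by (simp only: power_mult)
      qed
      also have "norm (G z - poly T z) powr (2 * m) \<le> 1 powr (2 * m)"
        using T[of z] z by (intro powr_mono2) auto
      finally show "norm (G z) powr (2 * m) \<le> 2 powr (2 * m) * ((norm (poly T z))\<^sup>2 ^ m + 1)" by simp
    qed (auto intro!: continuous_intros)
    also have "\<dots> = 2 powr (2 * m) * (circle_mean (\<lambda>z. (norm (poly T z))\<^sup>2 ^ m) 1 + 1)"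
    proof -
      have c: "continuous_on (sphere 0 1) (\<lambda>z. (norm (poly T z))\<^sup>2 ^ m)" by (intro continuous_intros)
      have "circle_mean (\<lambda>z. (norm (poly T z))\<^sup>2 ^ m + 1) 1 = circle_mean (\<lambda>z. (norm (poly T z))\<^sup>2 ^ m) 1 + 1"
        using c by (subst circle_mean_add) auto
      then show ?thesis using c by (subst circle_mean_mult) (auto intro!: continuous_on_add)
    qed
    also have "\<dots> \<le> 2 powr (2 * m) * (C m + 1)" using C[of m] by simp
    finally show ?thesis .
  qed
  have "bounded_means (2 * m) g"
    unfolding bounded_means_def
  proof (intro exI ballI)
    fix r :: real assume r: "r \<in> {0..<1}"
    show "circle_mean (\<lambda>z. norm (g z) powr (2 * m)) r
      \<le> max (norm (g 0) powr (2 * m)) (2 powr (2 * m) * (C m + 1))"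
      \<comment> \<open>The dilation argument needs a positive radius; at radius 0 the mean is the
        value at the centre.\<close>
      using bound[of r] r by (cases "r = 0") auto
  qed
  then show ?thesis using k q by (intro bounded_means_mono[OF cg q, of "2 * m"]) (auto simp: m_def)
qed

theorem theorem2p5:
  fixes g :: "complex \<Rightarrow> complex" and p1 p2 :: real
  assumes "g \<in> BMOA"
    and "\<not> g constant_on unit_disk"
    and "1 \<le> p1" and "p1 < p2"
  shows "optimal_domain (volterra g) (hardy_space p2) \<subset> optimal_domain (volterra g) (hardy_space p1)"
proof -
  note hg = BMOA_imp_holomorphic[OF assms(1)]
  obtain f where "f \<in> optimal_domain (volterra g) (hardy_space p1)"
    "f \<notin> optimal_domain (volterra g) (hardy_space p2)"
    using separating_function_exists[OF hg assms(2) BMOA_bounded_means[OF assms(1)] assms(3,4)] by blast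
  then show ?thesis using optimal_domain_mono[OF hg, of p1 p2] assms(3,4) by auto
qed

end
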